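(* Let $(X,d)$ be a proper geodesic Gromov hyperbolic metric space with approaching geodesics. Then the Busemann map induces a homeomorphism $\overline{X}^G\to\overline{X}^H$ extending the identity. Precisely, the map $\Psi\colon \overline{X}^G\to\overline{X}^H$ given by $$\Psi(\xi)=\begin{cases}[d(\,\cdot\,,\xi)], & \text{if } \xi\in X,\\ [B_\gamma], & \text{if } \xi=[\gamma]\in\partial_GX,\end{cases}$$ is well defined and is a homeomorphism; thus $\overline{X}^G$ and $\overline{X}^H$ are topologically equivalent compactifications of $X$.
   Context: A metric space is proper if all closed balls are compact, and geodesic if any two points are joined by a geodesic segment. A geodesic is a map $\gamma\colon I\to X$ from an interval $I\subset\mathbb{R}$ with $d(\gamma(s),\gamma(t))=|t-s|$ for all $s,t\in I$; it is a geodesic ray if $I=[0,+\infty)$. $\mathscr{R}(X)$ denotes the set of geodesic rays. Two rays $\gamma,\sigma$ are asymptotic if $t\mapsto d(\gamma(t),\sigma(t))$ is bounded, and strongly asymptotic if there exists $T\in\mathbb{R}$ with $\lim_{t\to+\infty}d(\gamma(t),\sigma(t+T))=0$. A proper geodesic metric space has approaching geodesics if any two asymptotic rays are strongly asymptotic. Gromov compactification: for $(X,d)$ proper geodesic Gromov hyperbolic, $\partial_GX$ is the set of equivalence classes $[\gamma]$ of geodesic rays under asymptoticity, and $\overline{X}^G=X\sqcup\partial_GX$ with its usual compact metrizable topology, in which $X$ is open and dense and carries its own topology. Fixing $p\in X$, a sequence $(x_n)$ in $\overline{X}^G$ converges to $\xi\in\partial_GX$ iff, choosing for each $n$ a geodesic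 segment $\gamma_n$ from $p$ to $x_n$ (if $x_n\in X$) or a geodesic ray $\gamma_n$ from $p$ representing $x_n$ (if $x_n\in\partial_GX$), every locally uniformly convergent subsequence of $(\gamma_n)$ has limit in the class $\xi$ (the choices do not matter). Horofunction compactification: let $C(X)$ be the space of continuous real functions on $X$ with uniform convergence on compact subsets, $C_*(X)$ its quotient by the constant functions, and $[f]$ the class of $f$. The map $i_H\colon X\to C_*(X)$, $x\mapsto[d(\,\cdot\,,x)]$, is an embedding; $\overline{X}^H$ is the closure of $i_H(X)$ in $C_*(X)$ and $\partial_HX=\overline{X}^H\setminus i_H(X)$. Busemann function: for a ray $\gamma$, $B_\gamma(x,y)=\lim_{t\to+\infty}\big(d(x,\gamma(t))-d(\gamma(t),y)\big)$ (the limit exists); $[B_\gamma]\in\partial_HX$ is the class of $x\mapsto B_\gamma(x,y)$, independent of $y$. The Busemann map is $\mathscr{R}(X)\to\partial_HX$, $\gamma\mapsto[B_\gamma]$. Two compactifications $i_1\colon X\to Y_1$, $i_2\colon X\to Y_2$ are topologically equivalent if there is a homeomorphism $h\colon Y_1\to Y_2$ with $h\circ i_1=i_2$. *)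

theory Defs
  imports "HOL-Analysis.Analysis"
begin

section \<open>Geodesics and hyperbolicity\<close>

definition proper_space :: "'a::metric_space itself \<Rightarrow> bool" where
  "proper_space _ \<longleftrightarrow> (\<forall>(x::'a) r. compact (cball x r))"

definition geodesic_on :: "real set \<Rightarrow> (real \<Rightarrow> 'a::metric_space) \<Rightarrow> bool" where
  "geodesic_on I \<gamma> \<longleftrightarrow> is_interval I \<and> (\<forall>s\<in>I. \<forall>t\<in>I. dist (\<gamma> s) (\<gamma> t) = \<bar>t - s\<bar>)"

definition geodesic_segment :: "'a::metric_space \<Rightarrow> 'a \<Rightarrow> (real \<Rightarrow> 'a) \<Rightarrow> bool" where
  "geodesic_segment x y \<gamma> \<longleftrightarrow>
     geodesic_on {0..dist x y} \<gamma> \<and> \<gamma> 0 = x \<and> \<gamma> (dist x y) = y"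

definition geodesic_space :: "'a::metric_space itself \<Rightarrow> bool" where
  "geodesic_space _ \<longleftrightarrow> (\<forall>x y::'a. \<exists>\<gamma>. geodesic_segment x y \<gamma>)"

definition geodesic_sides :: "'a::metric_space \<Rightarrow> 'a \<Rightarrow> 'a set set" where
  "geodesic_sides x y = {\<gamma> ` {0..dist x y} |\<gamma>. geodesic_segment x y \<gamma>}"

text \<open>Slim triangles. Testing only the side \<open>A\<close> is no restriction, since the three sides
  can be permuted cyclically.\<close>

definition gromov_hyperbolic :: "'a::metric_space itself \<Rightarrow> bool" where
  "gromov_hyperbolic _ \<longleftrightarrow> (\<exists>\<delta>\<ge>0. \<forall>x y z::'a. \<forall>A\<in>geodesic_sides x y.
     \<forall>B\<in>geodesic_sides y z. \<forall>C\<in>geodesic_sides z x. \<forall>a\<in>A. \<exists>b\<in>B \<union> C. dist a b \<le> \<delta>)"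

text \<open>A ray is represented by a total function; its values at negative reals are arbitrary,
  and no notion below depends on them.\<close>

definition geodesic_rays :: "(real \<Rightarrow> 'a::metric_space) set" where
  "geodesic_rays = {\<gamma>. geodesic_on {0..} \<gamma>}"

definition asymptotic :: "(real \<Rightarrow> 'a::metric_space) \<Rightarrow> (real \<Rightarrow> 'a) \<Rightarrow> bool" where
  "asymptotic \<gamma> \<sigma> \<longleftrightarrow> bounded ((\<lambda>t. dist (\<gamma> t) (\<sigma> t)) ` {0..})"

definition strongly_asymptotic :: "(real \<Rightarrow> 'a::metric_space) \<Rightarrow> (real \<Rightarrow> 'a) \<Rightarrow> bool" where
  "strongly_asymptotic \<gamma> \<sigma> \<longleftrightarrow> (\<exists>T. ((\<lambda>t. dist (\<gamma> t) (\<sigma> (t + T))) \<longlongrightarrow> 0) at_top)"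

definition approaching_geodesics :: "'a::metric_space itself \<Rightarrow> bool" where
  "approaching_geodesics _ \<longleftrightarrow> (\<forall>\<gamma>\<in>geodesic_rays. \<forall>\<sigma>\<in>geodesic_rays.
     asymptotic \<gamma> (\<sigma> :: real \<Rightarrow> 'a) \<longrightarrow> strongly_asymptotic \<gamma> \<sigma>)"


section \<open>Compactifications\<close>

definition compactification :: "('a::topological_space \<Rightarrow> 'b) \<Rightarrow> 'b topology \<Rightarrow> bool" where
  "compactification i Y \<longleftrightarrow> compact_space Y \<and> Hausdorff_space Y \<and>
     embedding_map euclidean Y i \<and> Y closure_of (range i) = topspace Y"

definition topologically_equivalent ::
  "('a::topological_space \<Rightarrow> 'b) \<Rightarrow> 'b topology \<Rightarrow> ('a \<Rightarrow> 'c) \<Rightarrow> 'c topology \<Rightarrow> bool" where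
  "topologically_equivalent i1 Y1 i2 Y2 \<longleftrightarrow> compactification i1 Y1 \<and> compactification i2 Y2 \<and>
     (\<exists>h. homeomorphic_map Y1 Y2 h \<and> h \<circ> i1 = i2)"


section \<open>The Gromov compactification\<close>

definition asymptotic_rel :: "((real \<Rightarrow> 'a::metric_space) \<times> (real \<Rightarrow> 'a)) set" where
  "asymptotic_rel = {(\<gamma>, \<sigma>). \<gamma> \<in> geodesic_rays \<and> \<sigma> \<in> geodesic_rays \<and> asymptotic \<gamma> \<sigma>}"

definition gromov_boundary :: "(real \<Rightarrow> 'a::metric_space) set set" where
  "gromov_boundary = geodesic_rays // asymptotic_rel"

type_synonym 'a gromov_point = "'a + (real \<Rightarrow> 'a) set"

definition gromov_points :: "'a::metric_space gromov_point set" where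
  "gromov_points = UNIV <+> gromov_boundary"

text \<open>Segments are prolonged by their constant end point, so that all arcs are maps on
  \<open>[0, \<infinity>)\<close> and locally uniform convergence makes sense for sequences of them.\<close>

definition gromov_arc :: "'a::metric_space \<Rightarrow> 'a gromov_point \<Rightarrow> (real \<Rightarrow> 'a) \<Rightarrow> bool" where
  "gromov_arc p z \<gamma> \<longleftrightarrow> (case z of
       Inl x \<Rightarrow> geodesic_segment p x \<gamma> \<and> (\<forall>t\<ge>dist p x. \<gamma> t = x)
     | Inr \<xi> \<Rightarrow> \<gamma> \<in> \<xi> \<and> \<gamma> 0 = p)"

definition gromov_converges ::
  "'a::metric_space \<Rightarrow> (nat \<Rightarrow> 'a gromov_point) \<Rightarrow> 'a gromov_point \<Rightarrow> bool" where
  "gromov_converges p u z \<longleftrightarrow> (case z of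
       Inl x \<Rightarrow> (\<exists>v. (\<forall>\<^sub>F n in sequentially. u n = Inl (v n)) \<and> v \<longlonglongrightarrow> x)
     | Inr \<xi> \<Rightarrow> (\<forall>c. (\<forall>n. gromov_arc p (u n) (c n)) \<longrightarrow>
         (\<forall>r g. strict_mono (r :: nat \<Rightarrow> nat) \<and>
             (\<forall>T. uniform_limit {0..T} (\<lambda>n. c (r n)) g sequentially) \<longrightarrow> g \<in> \<xi>)))"

text \<open>The topology being metrizable, it is determined by its convergent sequences: the open
  sets are the sequentially open ones.\<close>

definition gromov_open :: "'a::metric_space \<Rightarrow> 'a gromov_point set \<Rightarrow> bool" where
  "gromov_open p U \<longleftrightarrow> U \<subseteq> gromov_points \<and>
     (\<forall>z\<in>U. \<forall>u. range u \<subseteq> gromov_points \<and> gromov_converges p u z \<longrightarrow>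
        (\<forall>\<^sub>F n in sequentially. u n \<in> U))"

definition gromov_compactification :: "'a::metric_space \<Rightarrow> 'a gromov_point topology" where
  "gromov_compactification p = topology (gromov_open p)"

lemma istopology_gromov_open: "istopology (gromov_open p)"
  unfolding istopology_def
proof (intro conjI allI impI)
  fix S T assume S: "gromov_open p S" and T: "gromov_open p T"
  show "gromov_open p (S \<inter> T)"
    unfolding gromov_open_def
  proof (intro conjI ballI allI impI)
    show "S \<inter> T \<subseteq> gromov_points"
      using S by (auto simp: gromov_open_def)
  next
    fix z u assume z: "z \<in> S \<inter> T" and u: "range u \<subseteq> gromov_points \<and> gromov_converges p u z"
    have "\<forall>\<^sub>F n in sequentially. u n \<in> S" "\<forall>\<^sub>F n in sequentially. u n \<in> T"
      using S T z u unfolding gromov_open_def by blast+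
    then show "\<forall>\<^sub>F n in sequentially. u n \<in> S \<inter> T"
      by eventually_elim auto
  qed
next
  fix \<K> :: "'a gromov_point set set"
  assume K: "\<forall>S\<in>\<K>. gromov_open p S"
  show "gromov_open p (\<Union>\<K>)"
    unfolding gromov_open_def
  proof (intro conjI ballI allI impI)
    show "\<Union>\<K> \<subseteq> gromov_points"
      using K by (auto simp: gromov_open_def)
  next
    fix z u assume z: "z \<in> \<Union>\<K>" and u: "range u \<subseteq> gromov_points \<and> gromov_converges p u z"
    then obtain S where S: "S \<in> \<K>" "z \<in> S" by auto
    then have "\<forall>\<^sub>F n in sequentially. u n \<in> S"
      using K u unfolding gromov_open_def by blast
    then show "\<forall>\<^sub>F n in sequentially. u n \<in> \<Union>\<K>"
      by (rule eventually_mono) (use S in auto)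
  qed
qed

lemma openin_gromov_compactification:
  "openin (gromov_compactification p) U \<longleftrightarrow> gromov_open p U"
  by (simp add: gromov_compactification_def istopology_gromov_open topology_inverse')

lemma topspace_gromov_compactification: "topspace (gromov_compactification p) = gromov_points"
proof -
  have "gromov_open p gromov_points"
    by (auto simp: gromov_open_def image_subset_iff)
  then show ?thesis
    unfolding topspace_def openin_gromov_compactification by (auto simp: gromov_open_def)
qed


section \<open>The horofunction compactification\<close>

definition continuous_functions :: "('a::metric_space \<Rightarrow> real) set" where
  "continuous_functions = {f. continuous_on UNIV f}"

definition compact_conv_open :: "('a::metric_space \<Rightarrow> real) set \<Rightarrow> bool" where
  "compact_conv_open U \<longleftrightarrow> U \<subseteq> continuous_functions \<and>
     (\<forall>f\<in>U. \<exists>K e. compact K \<and> 0 < e \<and>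
        {g \<in> continuous_functions. \<forall>x\<in>K. \<bar>g x - f x\<bar> < e} \<subseteq> U)"

definition compact_conv_topology :: "('a::metric_space \<Rightarrow> real) topology" where
  "compact_conv_topology = topology compact_conv_open"

definition const_class :: "('a \<Rightarrow> real) \<Rightarrow> ('a \<Rightarrow> real) set" where
  "const_class f = {g. \<exists>c. \<forall>x. g x = f x + c}"

text \<open>The quotient of the space of continuous functions by the constants, with the quotient
  topology.\<close>

definition quotient_open :: "('a::metric_space \<Rightarrow> real) set set \<Rightarrow> bool" where
  "quotient_open V \<longleftrightarrow> V \<subseteq> const_class ` continuous_functions \<and>
     openin compact_conv_topology {f \<in> continuous_functions. const_class f \<in> V}"

definition quotient_by_constants :: "('a::metric_space \<Rightarrow> real) set topology" where
  "quotient_by_constants = topology quotient_open"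

lemma istopology_compact_conv_open: "istopology compact_conv_open"
  unfolding istopology_def
proof (intro conjI allI impI)
  fix S T :: "('a \<Rightarrow> real) set"
  assume S: "compact_conv_open S" and T: "compact_conv_open T"
  show "compact_conv_open (S \<inter> T)"
    unfolding compact_conv_open_def
  proof (intro conjI ballI)
    show "S \<inter> T \<subseteq> continuous_functions"
      using S by (auto simp: compact_conv_open_def)
  next
    fix f assume f: "f \<in> S \<inter> T"
    obtain K d where K: "compact K" "0 < d"
      "{g \<in> continuous_functions. \<forall>x\<in>K. \<bar>g x - f x\<bar> < d} \<subseteq> S"
      using S f unfolding compact_conv_open_def by blast
    obtain L e where L: "compact L" "0 < e"
      "{g \<in> continuous_functions. \<forall>x\<in>L. \<bar>g x - f x\<bar> < e} \<subseteq> T"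
      using T f unfolding compact_conv_open_def by blast
    have "compact (K \<union> L)" "0 < min d e"
      "{g \<in> continuous_functions. \<forall>x\<in>K \<union> L. \<bar>g x - f x\<bar> < min d e} \<subseteq> S \<inter> T"
      using K L by (auto intro: compact_Un)
    then show "\<exists>K e. compact K \<and> 0 < e \<and>
        {g \<in> continuous_functions. \<forall>x\<in>K. \<bar>g x - f x\<bar> < e} \<subseteq> S \<inter> T"
      by blast
  qed
next
  fix \<K> :: "('a \<Rightarrow> real) set set"
  assume K: "\<forall>S\<in>\<K>. compact_conv_open S"
  show "compact_conv_open (\<Union>\<K>)"
    unfolding compact_conv_open_def
  proof (intro conjI ballI)
    show "\<Union>\<K> \<subseteq> continuous_functions"
      using K by (auto simp: compact_conv_open_def)
  next
    fix f assume "f \<in> \<Union>\<K>"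
    then obtain S where S: "S \<in> \<K>" "f \<in> S" by auto
    then have "compact_conv_open S"
      using K by simp
    then obtain K e where "compact K" "0 < e"
      "{g \<in> continuous_functions. \<forall>x\<in>K. \<bar>g x - f x\<bar> < e} \<subseteq> S"
      using S(2) unfolding compact_conv_open_def by blast
    moreover have "S \<subseteq> \<Union>\<K>"
      using S(1) by (rule Union_upper)
    ultimately show "\<exists>K e. compact K \<and> 0 < e \<and>
        {g \<in> continuous_functions. \<forall>x\<in>K. \<bar>g x - f x\<bar> < e} \<subseteq> \<Union>\<K>"
      by (meson order_trans)
  qed
qed

lemma openin_compact_conv_topology:
  "openin compact_conv_topology U \<longleftrightarrow> compact_conv_open U"
  by (simp add: compact_conv_topology_def istopology_compact_conv_open topology_inverse')

lemma topspace_compact_conv_topology: "topspace compact_conv_topology = continuous_functions"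
proof -
  have "compact_conv_open continuous_functions"
    unfolding compact_conv_open_def using zero_less_one compact_empty by blast
  then show ?thesis
    unfolding topspace_def openin_compact_conv_topology by (auto simp: compact_conv_open_def)
qed

lemma istopology_quotient_open: "istopology quotient_open"
  unfolding istopology_def
proof (intro conjI allI impI)
  fix S T :: "('a \<Rightarrow> real) set set"
  assume S: "quotient_open S" and T: "quotient_open T"
  have "{f \<in> continuous_functions. const_class f \<in> S \<inter> T} =
     {f \<in> continuous_functions. const_class f \<in> S} \<inter> {f \<in> continuous_functions. const_class f \<in> T}"
    by auto
  moreover have "S \<inter> T \<subseteq> const_class ` continuous_functions"
    using S by (simp add: quotient_open_def le_infI1)
  ultimately show "quotient_open (S \<inter> T)"
    using S T by (simp add: quotient_open_def openin_Int)
next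
  fix \<K> :: "('a \<Rightarrow> real) set set set"
  assume K: "\<forall>S\<in>\<K>. quotient_open S"
  have "{f \<in> continuous_functions. const_class f \<in> \<Union>\<K>} =
     (\<Union>S\<in>\<K>. {f \<in> continuous_functions. const_class f \<in> S})"
    by auto
  moreover have "\<Union>\<K> \<subseteq> const_class ` continuous_functions"
    using K by (simp add: quotient_open_def Sup_le_iff)
  moreover have "openin compact_conv_topology
      (\<Union>S\<in>\<K>. {f \<in> continuous_functions. const_class f \<in> S})"
    by (rule openin_Union) (use K in \<open>auto simp: quotient_open_def\<close>)
  ultimately show "quotient_open (\<Union>\<K>)"
    by (simp add: quotient_open_def)
qed

lemma openin_quotient_by_constants: "openin quotient_by_constants V \<longleftrightarrow> quotient_open V"
  by (simp add: quotient_by_constants_def istopology_quotient_open topology_inverse')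

lemma topspace_quotient_by_constants:
  "topspace quotient_by_constants = const_class ` continuous_functions"
proof -
  have "{f \<in> continuous_functions. const_class f \<in> const_class ` continuous_functions} =
      topspace (compact_conv_topology :: ('a::metric_space \<Rightarrow> real) topology)"
    by (auto simp: topspace_compact_conv_topology)
  then have "quotient_open (const_class ` continuous_functions :: ('a \<Rightarrow> real) set set)"
    unfolding quotient_open_def by (metis openin_topspace order_refl)
  then show ?thesis
    unfolding topspace_def openin_quotient_by_constants
    by (intro equalityI Union_least Union_upper) (simp_all add: quotient_open_def)
qed

lemma quotient_map_const_class:
  "quotient_map compact_conv_topology quotient_by_constants const_class"
  unfolding quotient_map_def
  by (simp add: topspace_compact_conv_topology topspace_quotient_by_constants
      openin_quotient_by_constants quotient_open_def)

definition horo_embedding :: "'a::metric_space \<Rightarrow> ('a \<Rightarrow> real) set" where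
  "horo_embedding x = const_class (\<lambda>y. dist y x)"

definition horo_points :: "('a::metric_space \<Rightarrow> real) set set" where
  "horo_points = quotient_by_constants closure_of (range horo_embedding)"

definition horo_boundary :: "('a::metric_space \<Rightarrow> real) set set" where
  "horo_boundary = horo_points - range horo_embedding"

definition horo_compactification :: "('a::metric_space \<Rightarrow> real) set topology" where
  "horo_compactification = subtopology quotient_by_constants horo_points"


section \<open>The Busemann map\<close>

definition busemann :: "(real \<Rightarrow> 'a::metric_space) \<Rightarrow> 'a \<Rightarrow> 'a \<Rightarrow> real" where
  "busemann \<gamma> x y = Lim at_top (\<lambda>t. dist x (\<gamma> t) - dist (\<gamma> t) y)"

definition busemann_class :: "(real \<Rightarrow> 'a::metric_space) \<Rightarrow> 'a \<Rightarrow> ('a \<Rightarrow> real) set" where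
  "busemann_class \<gamma> y = const_class (\<lambda>x. busemann \<gamma> x y)"

text \<open>For \<open>\<xi>\<close> in the Gromov boundary the description is meaningful only if
  \<open>busemann_class \<gamma> y\<close> depends neither on \<open>\<gamma> \<in> \<xi>\<close> nor on \<open>y\<close>.\<close>

definition gromov_to_horo :: "'a::metric_space gromov_point \<Rightarrow> ('a \<Rightarrow> real) set" where
  "gromov_to_horo z = (case z of
       Inl x \<Rightarrow> horo_embedding x
     | Inr \<xi> \<Rightarrow> (THE c. \<exists>\<gamma>\<in>\<xi>. \<exists>y. c = busemann_class \<gamma> y))"

end

theory Submission
  imports Defs
begin

text \<open>Let \<open>h z\<close> be the horofunction of \<open>z\<close>, normalised to vanish at \<open>p\<close>: the function
  \<open>d(\<cdot>, z) - d(p, z)\<close> at interior points, the Busemann function at boundary points. All these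
  functions are 1-Lipschitz, so their closure is compact already for pointwise convergence and is
  a model of the horofunction compactification. If \<open>u\<^sub>n\<close> tends to a boundary point, then
  subsequences of the arcs from \<open>p\<close> and from \<open>y\<close> to \<open>u\<^sub>n\<close> converge to two rays, asymptotic by
  slimness of triangles, hence strongly asymptotic; the shift \<open>T\<close> between them is the limit of
  \<open>h u\<^sub>n y\<close> as well as the value at \<open>y\<close> of the Busemann function. Conversely, if the
  \<open>h u\<^sub>n\<close> converge to the Busemann function of a ray, then the latter decreases at unit speed
  along every limit of arcs from \<open>p\<close> to \<open>u\<^sub>n\<close>, and slimness makes this limit asymptotic to the
  given ray.\<close>

section \<open>Lipschitz arcs and segments\<close>

text \<open>The Gromov topology is given only through convergent sequences, so neither its
  compactness nor its separation is at hand at the start. A continuous bijection onto the compact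
  model would therefore not settle the matter: openness is proved directly, and compactness and the
  Hausdorff property come back through the homeomorphism. On the other side, pointwise convergence
  over an uncountable space is in general not governed by sequences. Equicontinuity and properness
  repair this: the balls \<open>cball p (real n)\<close> with precision
  \<open>1 / real (Suc n)\<close> give a countable base of neighbourhoods among the normalised
  functions. Slimness alone compares asymptotic rays up to a bounded error, which would survive in
  their Busemann functions. Strong asymptoticity removes the error; this makes a boundary class
  determine one horofunction and gives the horofunctions along converging arcs a limit. Interior and
  boundary points are treated together through \<open>horofunction\<close>, a cocycle in two base
  points that falls at unit speed along arcs towards the point.\<close>

lemma compact_finite_net:
  assumes "compact K" "0 < e"
  obtains F where "finite F" "F \<subseteq> K" "K \<subseteq> (\<Union>x\<in>F. ball x e)"
proof -
  have "\<exists>F. finite F \<and> F \<subseteq> K \<and> K \<subseteq> (\<Union>x\<in>F. ball x e)"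
    using assms by (simp add: seq_compact_imp_totally_bounded compact_eq_seq_compact_metric)
  then show thesis using that by (elim exE conjE)
qed

text \<open>Arzela-Ascoli: a diagonal subsequence converges at all rational times, because closed
  balls are compact. The common Lipschitz bound carries convergence over to real times, and a finite
  net of times makes it uniform on bounded intervals.\<close>

lemma lipschitz_arcs_subsequence:
  fixes c :: "nat \<Rightarrow> real \<Rightarrow> 'a::metric_space"
  assumes proper: "proper_space TYPE('a)"
    and start: "\<And>n. c n 0 = x"
    and lip: "\<And>n s t. 0 \<le> s \<Longrightarrow> 0 \<le> t \<Longrightarrow> dist (c n s) (c n t) \<le> \<bar>s - t\<bar>"
  obtains r :: "nat \<Rightarrow> nat" and g where "strict_mono r"
    "\<And>T. uniform_limit {0..T} (\<lambda>n. c (r n)) g sequentially"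
proof -
  \<comment> \<open>Indexing by the countable type of rationals makes the function space metrizable,
    so that compactness of the product gives sequential compactness. The absolute value moves
    negative indices into the range where the Lipschitz bound is assumed.\<close>
  define S where "S q = cball x \<bar>real_of_rat q\<bar>" for q
  define C where "C n q = c n \<bar>real_of_rat q\<bar>" for n q
  have "compactin (product_topology (\<lambda>q::rat. euclidean) UNIV) (PiE UNIV S)"
    using proper by (auto simp: compactin_PiE S_def proper_space_def)
  then have "compact (PiE UNIV S)"
    by (simp add: euclidean_product_topology compactin_euclidean_iff)
  then have "seq_compact (PiE UNIV S)"
    by (simp add: compact_eq_seq_compact_metric)
  moreover have "\<forall>n. C n \<in> PiE UNIV S"
    using lip[of 0] by (auto simp: S_def C_def start)
  ultimately obtain l r where r: "strict_mono r" and l: "(C \<circ> r) \<longlonglongrightarrow> l"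
    unfolding seq_compact_def by blast
  have Cl: "(\<lambda>n. C (r n) q) \<longlonglongrightarrow> l q" for q
    using continuous_on_tendsto_compose[OF continuous_on_product_coordinates[of q] l]
    by (simp add: o_def)
  have cauchy: "Cauchy (\<lambda>n. c (r n) t)" if t: "0 \<le> t" for t
  proof (rule metric_CauchyI)
    fix e :: real assume e: "0 < e"
    obtain q where q: "t < real_of_rat q" "real_of_rat q < t + e / 3"
      using of_rat_dense[of t "t + e / 3"] e by auto
    have "Cauchy (\<lambda>n. C (r n) q)"
      using Cl by (rule LIMSEQ_imp_Cauchy)
    then obtain N where N: "\<And>m n. m \<ge> N \<Longrightarrow> n \<ge> N \<Longrightarrow> dist (C (r m) q) (C (r n) q) < e / 3"
      using e by (meson metric_CauchyD divide_pos_pos zero_less_numeral)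
    have near: "dist (c n t) (C n q) < e / 3" for n
    proof -
      have "\<bar>real_of_rat q\<bar> = real_of_rat q" using t q by linarith
      then show ?thesis
        unfolding C_def using lip[of t "real_of_rat q" n] t q by linarith
    qed
    show "\<exists>M. \<forall>m\<ge>M. \<forall>n\<ge>M. dist (c (r m) t) (c (r n) t) < e"
    proof (intro exI allI impI)
      fix m n assume "m \<ge> N" "n \<ge> N"
      then show "dist (c (r m) t) (c (r n) t) < e"
        using N[of m n] near[of "r m"] near[of "r n"]
          dist_triangle[of "c (r m) t" "c (r n) t" "C (r m) q"]
          dist_triangle[of "C (r m) q" "c (r n) t" "C (r n) q"]
        by (simp add: dist_commute)
    qed
  qed
  have "convergent (\<lambda>n. c (r n) t)" if t: "0 \<le> t" for t
  proof -
    have "complete (cball x t)"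
      using proper by (simp add: proper_space_def compact_imp_complete)
    moreover have "\<forall>n. c (r n) t \<in> cball x t"
      using lip[of 0 t] t by (auto simp: start)
    ultimately obtain l where "(\<lambda>n. c (r n) t) \<longlonglongrightarrow> l"
      using cauchy[OF t] by (rule completeE)
    then show ?thesis by (rule convergentI)
  qed
  then have lim: "(\<lambda>n. c (r n) t) \<longlonglongrightarrow> lim (\<lambda>n. c (r n) t)" if "0 \<le> t" for t
    using that by (simp add: convergent_LIMSEQ_iff)
  define g where "g t = lim (\<lambda>n. c (r n) t)" for t
  have glip: "dist (g s) (g t) \<le> \<bar>s - t\<bar>" if "0 \<le> s" "0 \<le> t" for s t
    unfolding g_def using that lip
    by (intro tendsto_upperbound[OF tendsto_dist[OF lim lim]]) auto
  have "uniform_limit {0..T} (\<lambda>n. c (r n)) g sequentially" for T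
  proof (rule uniform_limitI)
    fix e :: real assume e: "0 < e"
    obtain F where F: "finite F" "F \<subseteq> {0..T}" "{0..T} \<subseteq> (\<Union>s\<in>F. ball s (e / 3))"
      by (rule compact_finite_net[OF compact_Icc[of 0 T], of "e / 3"]) (use e in auto)
    have "\<forall>\<^sub>F n in sequentially. \<forall>s\<in>F. dist (c (r n) s) (g s) < e / 3"
      using F lim e unfolding g_def
      by (intro eventually_ball_finite ballI tendstoD) auto
    then show "\<forall>\<^sub>F n in sequentially. \<forall>t\<in>{0..T}. dist (c (r n) t) (g t) < e"
    proof eventually_elim
      case (elim n)
      show ?case
      proof
        fix t assume t: "t \<in> {0..T}"
        then obtain s where s: "s \<in> F" "dist s t < e / 3" using F by auto
        then have "0 \<le> s" using F by auto
        then have "dist (c (r n) t) (c (r n) s) < e / 3" "dist (g s) (g t) < e / 3"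
          using lip[of t s "r n"] glip[of s t] t s abs_minus_commute[of s t] by (auto simp: dist_real_def)
        then show "dist (c (r n) t) (g t) < e"
          using elim s dist_triangle[of "c (r n) t" "g t" "c (r n) s"]
            dist_triangle[of "c (r n) s" "g t" "g s"] by fastforce
      qed
    qed
  qed
  with r show thesis using that by blast
qed

lemma geodesic_onD:
  "geodesic_on I \<gamma> \<Longrightarrow> s \<in> I \<Longrightarrow> t \<in> I \<Longrightarrow> dist (\<gamma> s) (\<gamma> t) = \<bar>t - s\<bar>"
  by (auto simp: geodesic_on_def)

lemma geodesic_on_subset:
  "geodesic_on I \<gamma> \<Longrightarrow> J \<subseteq> I \<Longrightarrow> is_interval J \<Longrightarrow> geodesic_on J \<gamma>"
  by (auto simp: geodesic_on_def)

lemma geodesic_segmentI: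
  assumes "geodesic_on {0..A} \<gamma>" "0 \<le> A"
  shows "geodesic_segment (\<gamma> 0) (\<gamma> A) \<gamma>" "dist (\<gamma> 0) (\<gamma> A) = A"
proof -
  show A: "dist (\<gamma> 0) (\<gamma> A) = A"
    using geodesic_onD[OF assms(1), of 0 A] assms(2) by simp
  show "geodesic_segment (\<gamma> 0) (\<gamma> A) \<gamma>"
    using assms by (simp add: geodesic_segment_def A)
qed

lemma image_in_geodesic_sides:
  assumes "geodesic_on {0..A} \<gamma>" "0 \<le> A"
  shows "\<gamma> ` {0..A} \<in> geodesic_sides (\<gamma> 0) (\<gamma> A)"
  using geodesic_segmentI[OF assms] by (force simp: geodesic_sides_def)

lemma geodesic_sides_dist:
  assumes "A \<in> geodesic_sides x y" "a \<in> A"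
  shows "dist x a + dist a y = dist x y"
proof -
  obtain \<gamma> t where *: "geodesic_segment x y \<gamma>" "a = \<gamma> t" "0 \<le> t" "t \<le> dist x y"
    using assms by (auto simp: geodesic_sides_def)
  then have "dist (\<gamma> 0) (\<gamma> t) = t" "dist (\<gamma> t) (\<gamma> (dist x y)) = dist x y - t"
    unfolding geodesic_segment_def
    using geodesic_onD[of "{0..dist x y}" \<gamma> 0 t] geodesic_onD[of "{0..dist x y}" \<gamma> t "dist x y"]
    by auto
  with * show ?thesis by (simp add: geodesic_segment_def)
qed

text \<open>By reversal of the parameter. Slimness is stated for sides oriented cyclically, whereas
  the triangles below are assembled from sides with either orientation.\<close>

lemma geodesic_sides_commute: "geodesic_sides x y = geodesic_sides y x"
proof -
  have "geodesic_sides x y \<subseteq> geodesic_sides y x" for x y :: 'a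
  proof
    fix A assume "A \<in> geodesic_sides x y"
    then obtain \<gamma> where \<gamma>: "geodesic_segment x y \<gamma>" "A = \<gamma> ` {0..dist x y}"
      by (auto simp: geodesic_sides_def)
    define \<sigma> where "\<sigma> t = \<gamma> (dist x y - t)" for t
    have "geodesic_segment y x \<sigma>"
      using \<gamma> by (auto simp: geodesic_segment_def geodesic_on_def \<sigma>_def dist_commute)
    moreover have "A = \<sigma> ` {0..dist y x}"
    proof -
      have "{0..dist x y} = (\<lambda>t. dist x y - t) ` {0..dist y x}"
        by (simp add: dist_commute)
      then show ?thesis
        unfolding \<gamma>(2) \<sigma>_def by (metis image_image)
    qed
    ultimately show "A \<in> geodesic_sides y x"
      unfolding geodesic_sides_def by blast
  qed
  then show ?thesis by blast
qed

lemma geodesic_rays_dist: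
  "\<gamma> \<in> geodesic_rays \<Longrightarrow> 0 \<le> s \<Longrightarrow> 0 \<le> t \<Longrightarrow> dist (\<gamma> s) (\<gamma> t) = \<bar>t - s\<bar>"
  by (auto simp: geodesic_rays_def geodesic_on_def)

lemma geodesic_rays_on: "\<gamma> \<in> geodesic_rays \<Longrightarrow> geodesic_on {0..A} \<gamma>"
  unfolding geodesic_rays_def by (auto intro: geodesic_on_subset simp: is_interval_cc)

section \<open>Asymptotic rays and their classes\<close>

lemma asymptotic_iff:
  "asymptotic \<gamma> \<sigma> \<longleftrightarrow> (\<exists>M. \<forall>t\<ge>0. dist (\<gamma> t) (\<sigma> t) \<le> M)"
  by (auto simp: asymptotic_def bounded_iff)

lemma asymptotic_refl: "asymptotic \<gamma> \<gamma>"
  unfolding asymptotic_iff by (intro exI[of _ 0]) simp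

lemma asymptotic_commute: "asymptotic \<gamma> \<sigma> \<longleftrightarrow> asymptotic \<sigma> \<gamma>"
  by (simp add: asymptotic_def dist_commute)

lemma asymptotic_trans:
  assumes "asymptotic \<gamma> \<sigma>" "asymptotic \<sigma> \<tau>" shows "asymptotic \<gamma> \<tau>"
proof -
  obtain M N where "\<And>t. t \<ge> 0 \<Longrightarrow> dist (\<gamma> t) (\<sigma> t) \<le> M" "\<And>t. t \<ge> 0 \<Longrightarrow> dist (\<sigma> t) (\<tau> t) \<le> N"
    using assms unfolding asymptotic_iff by blast
  then have "dist (\<gamma> t) (\<tau> t) \<le> M + N" if "t \<ge> 0" for t
    using that dist_triangle[of "\<gamma> t" "\<tau> t" "\<sigma> t"] by force
  then show ?thesis unfolding asymptotic_iff by blast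
qed

lemma equiv_asymptotic_rel: "equiv geodesic_rays asymptotic_rel"
proof (rule equivI)
  show "asymptotic_rel \<subseteq> geodesic_rays \<times> geodesic_rays"
    by (auto simp: asymptotic_rel_def)
  show "refl_on geodesic_rays asymptotic_rel"
    by (simp add: refl_on_def asymptotic_rel_def asymptotic_refl)
  show "sym asymptotic_rel"
    by (auto simp: sym_def asymptotic_rel_def asymptotic_commute)
  show "trans asymptotic_rel"
    by (clarsimp simp: trans_def asymptotic_rel_def) (erule (1) asymptotic_trans)
qed

lemma gromov_boundary_rays: "\<xi> \<in> gromov_boundary \<Longrightarrow> \<gamma> \<in> \<xi> \<Longrightarrow> \<gamma> \<in> geodesic_rays"
  unfolding gromov_boundary_def using in_quotient_imp_subset[OF equiv_asymptotic_rel] by blast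

lemma gromov_boundary_mem_iff:
  assumes "\<xi> \<in> gromov_boundary" "\<gamma> \<in> \<xi>"
  shows "\<sigma> \<in> \<xi> \<longleftrightarrow> \<sigma> \<in> geodesic_rays \<and> asymptotic \<gamma> \<sigma>"
proof
  assume "\<sigma> \<in> \<xi>"
  then have "(\<gamma>, \<sigma>) \<in> asymptotic_rel"
    using assms in_quotient_imp_in_rel[OF equiv_asymptotic_rel, of \<xi> \<gamma> \<sigma>]
    by (simp add: gromov_boundary_def)
  then show "\<sigma> \<in> geodesic_rays \<and> asymptotic \<gamma> \<sigma>"
    by (simp add: asymptotic_rel_def)
next
  assume "\<sigma> \<in> geodesic_rays \<and> asymptotic \<gamma> \<sigma>"
  then have "(\<gamma>, \<sigma>) \<in> asymptotic_rel"
    using assms gromov_boundary_rays by (simp add: asymptotic_rel_def)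
  then show "\<sigma> \<in> \<xi>"
    using assms in_quotient_imp_closed[OF equiv_asymptotic_rel, of \<xi> \<gamma> \<sigma>]
    by (simp add: gromov_boundary_def)
qed

lemma gromov_boundary_nonempty: "\<xi> \<in> gromov_boundary \<Longrightarrow> \<exists>\<gamma>. \<gamma> \<in> \<xi>"
  unfolding gromov_boundary_def using in_quotient_imp_non_empty[OF equiv_asymptotic_rel] by blast

lemma asymptotic_class_in_boundary:
  assumes "\<gamma> \<in> geodesic_rays"
  shows "asymptotic_rel `` {\<gamma>} \<in> gromov_boundary" "\<gamma> \<in> asymptotic_rel `` {\<gamma>}"
proof -
  show "asymptotic_rel `` {\<gamma>} \<in> gromov_boundary"
    unfolding gromov_boundary_def using assms by (rule quotientI)
  show "\<gamma> \<in> asymptotic_rel `` {\<gamma>}"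
    using assms by (simp add: asymptotic_rel_def asymptotic_refl)
qed

section \<open>Arcs in hyperbolic spaces\<close>

text \<open>The parameter interval of an arc from \<open>x\<close> to \<open>z\<close> ends at \<open>dist x z\<close> or is infinite;
  \<open>arc_time\<close> truncates \<open>t\<close> to it, which treats interior and boundary points alike.\<close>

definition arc_time :: "'a::metric_space \<Rightarrow> 'a gromov_point \<Rightarrow> real \<Rightarrow> real" where
  "arc_time x z t = (case z of Inl w \<Rightarrow> min t (dist x w) | Inr _ \<Rightarrow> t)"

lemma arc_time_lipschitz: "\<bar>arc_time x z s - arc_time x z t\<bar> \<le> \<bar>s - t\<bar>"
  by (auto simp: arc_time_def min_def split: sum.split)

text \<open>The triangle inequality between the two lengths. It transfers the information that arcs
  become long from one base point to another.\<close>

lemma arc_time_change_base: "arc_time x z t - dist x y \<le> arc_time y z t"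
proof (cases z)
  case (Inl w)
  then show ?thesis
    using dist_triangle[of x w y] zero_le_dist[of x y]
    unfolding arc_time_def min_def by (simp del: zero_le_dist)
qed (simp add: arc_time_def)

lemma gromov_arc_start: "gromov_arc x z c \<Longrightarrow> c 0 = x"
  by (auto simp: gromov_arc_def geodesic_segment_def split: sum.splits)

lemma gromov_arc_dist:
  assumes "z \<in> gromov_points" "gromov_arc x z c" "0 \<le> s" "0 \<le> t"
  shows "dist (c s) (c t) = \<bar>arc_time x z t - arc_time x z s\<bar>"
proof (cases z)
  case (Inl w)
  have c: "c u = c (min u (dist x w))" if "0 \<le> u" for u
    using assms(2) Inl that by (auto simp: gromov_arc_def geodesic_segment_def min_def)
  show ?thesis
    using assms Inl geodesic_onD[of "{0..dist x w}" c "min s (dist x w)" "min t (dist x w)"]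
    by (simp add: c[of s] c[of t] arc_time_def gromov_arc_def geodesic_segment_def)
next
  case (Inr \<xi>)
  then have "c \<in> geodesic_rays"
    using assms(1,2) gromov_boundary_rays by (auto simp: gromov_points_def gromov_arc_def)
  then show ?thesis
    using geodesic_rays_dist assms(3,4) by (auto simp: Inr arc_time_def)
qed

lemma gromov_arc_lipschitz:
  assumes "z \<in> gromov_points" "gromov_arc x z c" "0 \<le> s" "0 \<le> t"
  shows "dist (c s) (c t) \<le> \<bar>s - t\<bar>"
  using gromov_arc_dist[OF assms] arc_time_lipschitz[of x z s t] by linarith

text \<open>Each bounded time interval is eventually covered by the isometric part of the arcs, and
  the distance identity passes to the limit. Without \<open>long\<close> the limit could become
  constant after a finite time.\<close>

lemma gromov_arcs_limit_ray:
  assumes u: "\<And>n. u n \<in> gromov_points"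
    and c: "\<And>n. gromov_arc x (u n) (c n)"
    and lim: "\<And>t. 0 \<le> t \<Longrightarrow> (\<lambda>n. c n t) \<longlonglongrightarrow> g t"
    and long: "\<And>t. 0 \<le> t \<Longrightarrow> \<forall>\<^sub>F n in sequentially. arc_time x (u n) t = t"
  shows "g \<in> geodesic_rays" "g 0 = x"
proof -
  have "dist (g s) (g t) = \<bar>t - s\<bar>" if st: "0 \<le> s" "0 \<le> t" for s t
  proof (rule LIMSEQ_unique)
    show "(\<lambda>n. dist (c n s) (c n t)) \<longlonglongrightarrow> dist (g s) (g t)"
      using st by (intro tendsto_dist lim)
    have "\<forall>\<^sub>F n in sequentially. dist (c n s) (c n t) = \<bar>t - s\<bar>"
      using long[OF st(1)] long[OF st(2)]
      by eventually_elim (use gromov_arc_dist[OF u c st] in simp)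
    then show "(\<lambda>n. dist (c n s) (c n t)) \<longlonglongrightarrow> \<bar>t - s\<bar>"
      by (rule tendsto_eventually)
  qed
  then show "g \<in> geodesic_rays"
    by (auto simp: geodesic_rays_def geodesic_on_def is_interval_ci)
  show "g 0 = x"
    using lim[of 0] gromov_arc_start[OF c] by (simp add: LIMSEQ_const_iff)
qed

locale slim_proper_geodesic_space =
  fixes \<delta> :: real and p :: "'a::metric_space"
  assumes proper: "proper_space TYPE('a)"
    and geodesic: "geodesic_space TYPE('a)"
    and delta_nonneg: "0 \<le> \<delta>"
    and slim: "\<And>x y z A B C a. A \<in> geodesic_sides x y \<Longrightarrow> B \<in> geodesic_sides y z \<Longrightarrow>
      C \<in> geodesic_sides z (x::'a) \<Longrightarrow> a \<in> A \<Longrightarrow> \<exists>b\<in>B \<union> C. dist a b \<le> \<delta>"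
begin

lemma sides_nonempty: "\<exists>A. A \<in> geodesic_sides (x::'a) y"
  using geodesic unfolding geodesic_space_def geodesic_sides_def by blast

text \<open>The quadrilateral formed by the two segments, a side joining the starts and a side
  joining the ends is cut by a diagonal, and slimness is applied to both triangles. The hypothesis
  \<open>far\<close> keeps \<open>\<sigma> t\<close> away from the side joining the ends, so the
  bound involves only the distance of the starts.\<close>

lemma fellow_travel:
  fixes \<sigma> \<tau> :: "real \<Rightarrow> 'a"
  assumes \<sigma>: "geodesic_on {0..A} \<sigma>" and \<tau>: "geodesic_on {0..B} \<tau>"
    and t: "0 \<le> t" "t \<le> A" "t \<le> B" and far: "2 * \<delta> + dist (\<sigma> A) (\<tau> B) < A - t"
  shows "dist (\<sigma> t) (\<tau> t) \<le> 4 * \<delta> + 3 * dist (\<sigma> 0) (\<tau> 0)"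
proof -
  define d where "d = dist (\<sigma> 0) (\<tau> 0)"
  have S: "\<sigma> ` {0..A} \<in> geodesic_sides (\<sigma> 0) (\<sigma> A)"
    using \<sigma> t by (intro image_in_geodesic_sides) auto
  have T: "\<tau> ` {0..B} \<in> geodesic_sides (\<tau> 0) (\<tau> B)"
    using \<tau> t by (intro image_in_geodesic_sides) auto
  \<comment> \<open>\<open>D\<close> is the diagonal, \<open>E\<close> joins the starts and
    \<open>M\<close> joins the ends. The triangles are \<open>\<sigma> 0\<close>,
    \<open>\<sigma> A\<close>, \<open>\<tau> 0\<close> and \<open>\<tau> 0\<close>,
    \<open>\<sigma> A\<close>, \<open>\<tau> B\<close>.\<close>
  obtain D where D: "D \<in> geodesic_sides (\<sigma> A) (\<tau> 0)" using sides_nonempty by blast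
  obtain E where E: "E \<in> geodesic_sides (\<tau> 0) (\<sigma> 0)" using sides_nonempty by blast
  obtain M where M: "M \<in> geodesic_sides (\<tau> B) (\<sigma> A)" using sides_nonempty by blast
  have "\<exists>s\<in>{0..B}. dist (\<sigma> t) (\<tau> s) \<le> 2 * \<delta> + d"
  proof -
    have "\<sigma> t \<in> \<sigma> ` {0..A}" using t by auto
    from slim[OF S D E this] obtain b where b: "b \<in> D \<union> E" "dist (\<sigma> t) b \<le> \<delta>" by blast
    show ?thesis
    proof (cases "b \<in> E")
      case True
      have "dist (\<tau> 0) b \<le> d"
        using geodesic_sides_dist[OF E True] zero_le_dist[of b "\<sigma> 0"]
          dist_commute[of "\<tau> 0" "\<sigma> 0"]
        unfolding d_def by linarith
      then have "dist (\<sigma> t) (\<tau> 0) \<le> 2 * \<delta> + d"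
        using b(2) delta_nonneg dist_triangle[of "\<sigma> t" "\<tau> 0" b] by (simp add: dist_commute)
      then show ?thesis using t by force
    next
      case False
      then have "b \<in> D" using b by auto
      moreover have "D \<in> geodesic_sides (\<tau> 0) (\<sigma> A)" "\<tau> ` {0..B} \<in> geodesic_sides (\<tau> B) (\<tau> 0)"
        "M \<in> geodesic_sides (\<sigma> A) (\<tau> B)"
        using D T M geodesic_sides_commute by auto
      ultimately obtain b' where b': "b' \<in> M \<union> \<tau> ` {0..B}" "dist b b' \<le> \<delta>"
        using slim by meson
      then have near: "dist (\<sigma> t) b' \<le> 2 * \<delta>"
        using b(2) dist_triangle[of "\<sigma> t" b' b] by simp
      \<comment> \<open>Otherwise \<open>\<sigma> t\<close> would reach \<open>\<sigma> A\<close>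
        within 2\<delta> plus the length of \<open>M\<close>, contrary to
        \<open>far\<close>.\<close>
      have "b' \<notin> M"
      proof
        assume "b' \<in> M"
        then have "dist b' (\<sigma> A) \<le> dist (\<sigma> A) (\<tau> B)"
          using geodesic_sides_dist[OF M \<open>b' \<in> M\<close>] zero_le_dist[of "\<tau> B" b']
            dist_commute[of "\<tau> B" "\<sigma> A"] by linarith
        moreover have "dist (\<sigma> t) (\<sigma> A) = A - t"
          using geodesic_onD[OF \<sigma>, of t A] t by auto
        ultimately show False
          using near far dist_triangle[of "\<sigma> t" "\<sigma> A" b'] by linarith
      qed
      then obtain s where "s \<in> {0..B}" "b' = \<tau> s" using b' by auto
      moreover have "0 \<le> d" by (simp add: d_def)
      ultimately show ?thesis using near by (intro bexI[of _ s]) auto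
    qed
  qed
  then obtain s where s: "0 \<le> s" "s \<le> B" "dist (\<sigma> t) (\<tau> s) \<le> 2 * \<delta> + d" by auto
  \<comment> \<open>Comparing the distances of \<open>\<sigma> t\<close> and \<open>\<tau> s\<close>
    from their starts gives |t - s| \<le> 2\<delta> + 2d. Added to the 2\<delta> + d just obtained,
    this is the constant 4\<delta> + 3d.\<close>
  have "dist (\<sigma> 0) (\<sigma> t) = t" using geodesic_onD[OF \<sigma>, of 0 t] t by auto
  moreover have "dist (\<tau> 0) (\<tau> s) = s" using geodesic_onD[OF \<tau>, of 0 s] s by auto
  moreover have "dist (\<tau> s) (\<tau> t) = \<bar>t - s\<bar>" using geodesic_onD[OF \<tau>, of s t] s t by auto
  ultimately show ?thesis
    using s(3) dist_triangle[of "\<sigma> t" "\<tau> t" "\<tau> s"] dist_triangle[of "\<sigma> 0" "\<sigma> t" "\<tau> 0"]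
      dist_triangle[of "\<tau> 0" "\<sigma> t" "\<tau> s"] dist_triangle[of "\<tau> 0" "\<tau> s" "\<sigma> 0"]
      dist_triangle[of "\<sigma> 0" "\<tau> s" "\<sigma> t"]
    unfolding d_def by (simp add: dist_commute)
qed

text \<open>Arcs to an interior point end at the same point, and the length condition leaves more
  than 2\<delta> beyond time \<open>t\<close>. Arcs to a boundary point are cut off far out. The
  bound does not involve the unspecified constant of asymptoticity, so it is uniform along a
  sequence of end points and survives a limit.\<close>

lemma gromov_arcs_fellow_travel:
  assumes z: "z \<in> gromov_points" and c: "gromov_arc x z c" and c': "gromov_arc y z c'"
    and t: "0 \<le> t" "arc_time x z (t + 2 * \<delta> + 1) = t + 2 * \<delta> + 1" "arc_time y z t = t"
  shows "dist (c t) (c' t) \<le> 4 * \<delta> + 3 * dist x (y::'a)"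
proof -
  have "\<exists>A B. geodesic_on {0..A} c \<and> geodesic_on {0..B} c' \<and> t \<le> A \<and> t \<le> B \<and>
      2 * \<delta> + dist (c A) (c' B) < A - t"
  proof (cases z)
    case (Inl w)
    then have "geodesic_on {0..dist x w} c" "geodesic_on {0..dist y w} c'"
      "c (dist x w) = w" "c' (dist y w) = w"
      using c c' by (auto simp: gromov_arc_def geodesic_segment_def)
    then show ?thesis
      using t delta_nonneg Inl
      by (intro exI[of _ "dist x w"] exI[of _ "dist y w"]) (auto simp: arc_time_def min_def split: if_splits)
  next
    case (Inr \<xi>)
    then have \<xi>: "\<xi> \<in> gromov_boundary" "c \<in> \<xi>" "c' \<in> \<xi>"
      using z c c' by (auto simp: gromov_points_def gromov_arc_def)
    then have "asymptotic c c'"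
      using gromov_boundary_mem_iff[of \<xi> c c'] by simp
    then obtain M where M: "\<And>t. t \<ge> 0 \<Longrightarrow> dist (c t) (c' t) \<le> M"
      unfolding asymptotic_iff by blast
    have M0: "0 \<le> M" using M[of 0] zero_le_dist[of "c 0" "c' 0"] by linarith
    have "geodesic_on {0..A} c" "geodesic_on {0..A} c'" for A
      using \<xi> by (auto intro: geodesic_rays_on gromov_boundary_rays)
    then show ?thesis
      \<comment> \<open>At this time the arcs are at most \<open>M\<close> apart, and the distance
        to time \<open>t\<close> exceeds 2\<delta> + \<open>M\<close> by 1.\<close>
      using M[of "t + 2 * \<delta> + M + 1"] M0 t delta_nonneg
      by (intro exI[of _ "t + 2 * \<delta> + M + 1"]) auto
  qed
  then obtain A B where "geodesic_on {0..A} c" "geodesic_on {0..B} c'" "t \<le> A" "t \<le> B"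
    "2 * \<delta> + dist (c A) (c' B) < A - t" by blast
  then show ?thesis
    using fellow_travel[of A c B c' t] t(1) gromov_arc_start[OF c] gromov_arc_start[OF c'] by simp
qed

lemma gromov_arc_interior_exists: "\<exists>c. gromov_arc (x::'a) (Inl w) c"
proof -
  obtain \<gamma> where \<gamma>: "geodesic_segment x w \<gamma>"
    using geodesic unfolding geodesic_space_def by blast
  have "gromov_arc x (Inl w) (\<lambda>t. \<gamma> (min t (dist x w)))"
    using \<gamma> by (simp add: gromov_arc_def geodesic_segment_def geodesic_on_def)
  then show ?thesis by blast
qed

lemma gromov_arcs_subsequence:
  assumes "\<And>n. u n \<in> gromov_points" "\<And>n. gromov_arc (x::'a) (u n) (c n)"
  obtains r :: "nat \<Rightarrow> nat" and g where "strict_mono r"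
    "\<And>T. uniform_limit {0..T} (\<lambda>n. c (r n)) g sequentially"
    "\<And>t. 0 \<le> t \<Longrightarrow> (\<lambda>n. c (r n) t) \<longlonglongrightarrow> g t"
proof -
  obtain r :: "nat \<Rightarrow> nat" and g where rg: "strict_mono r"
    "\<And>T. uniform_limit {0..T} (\<lambda>n. c (r n)) g sequentially"
    by (rule lipschitz_arcs_subsequence[where c = c, OF proper gromov_arc_start[OF assms(2)]
          gromov_arc_lipschitz[OF assms]]) (assumption | rule that)+
  moreover have "(\<lambda>n. c (r n) t) \<longlonglongrightarrow> g t" if "0 \<le> t" for t
    using tendsto_uniform_limitI[OF rg(2), of t t] that by auto
  ultimately show thesis using that by blast
qed

text \<open>The ray is a limit of segments from \<open>x\<close> to the points
  \<open>\<gamma> n\<close>. Each of them fellow-travels with \<open>\<gamma>\<close>, since the two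
  share their far end.\<close>

lemma asymptotic_ray_exists:
  assumes \<gamma>: "\<gamma> \<in> geodesic_rays"
  shows "\<exists>\<tau>\<in>geodesic_rays. \<tau> 0 = (x::'a) \<and> asymptotic \<gamma> \<tau>"
proof -
  define u :: "nat \<Rightarrow> 'a gromov_point" where "u n = Inl (\<gamma> (real n))" for n
  have u: "u n \<in> gromov_points" for n by (auto simp: u_def gromov_points_def)
  have "\<forall>n. \<exists>c. gromov_arc x (u n) c"
    unfolding u_def using gromov_arc_interior_exists by blast
  then obtain c where c: "\<And>n. gromov_arc x (u n) (c n)" by metis
  obtain r :: "nat \<Rightarrow> nat" and g where rg: "strict_mono r"
    "\<And>t. 0 \<le> t \<Longrightarrow> (\<lambda>n. c (r n) t) \<longlonglongrightarrow> g t"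
    by (rule gromov_arcs_subsequence[where c = c, OF u c]) (rule that)
  have far: "real n - dist x (\<gamma> 0) \<le> dist x (\<gamma> n)" for n
    using geodesic_rays_dist[OF \<gamma>, of 0 n] dist_triangle[of "\<gamma> 0" "\<gamma> n" x]
    by (simp add: dist_commute)
  have rn: "\<forall>\<^sub>F n in sequentially. K \<le> real (r n)" for K
    using filterlim_compose[OF filterlim_real_sequentially filterlim_subseq[OF rg(1)]]
    by (simp add: filterlim_at_top)
  have long: "\<forall>\<^sub>F n in sequentially. arc_time x (u (r n)) t = t" for t
    using rn[of "t + dist x (\<gamma> 0)"]
  proof eventually_elim
    case (elim n)
    then show ?case using far[of "r n"] by (auto simp: u_def arc_time_def)
  qed
  have g: "g \<in> geodesic_rays" "g 0 = x"
    using gromov_arcs_limit_ray[of "u \<circ> r" x "c \<circ> r" g] u c rg(2) long by auto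
  have "dist (\<gamma> t) (g t) \<le> 4 * \<delta> + 3 * dist (\<gamma> 0) x" if t: "0 \<le> t" for t
  proof (rule tendsto_upperbound)
    show "(\<lambda>n. dist (\<gamma> t) (c (r n) t)) \<longlonglongrightarrow> dist (\<gamma> t) (g t)"
      using rg(2) t by (intro tendsto_dist tendsto_const)
    show "\<forall>\<^sub>F n in sequentially. dist (\<gamma> t) (c (r n) t) \<le> 4 * \<delta> + 3 * dist (\<gamma> 0) x"
      \<comment> \<open>With \<open>r n\<close> this large, the piece of \<open>\<gamma>\<close>
        extends more than 2\<delta> past \<open>t\<close>. The summand
        \<open>dist x (\<gamma> 0)\<close> ensures that the segment from \<open>x\<close> is also
        longer than \<open>t\<close>.\<close>
      using rn[of "t + 2 * \<delta> + 1 + dist x (\<gamma> 0)"]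
    proof eventually_elim
      case (elim n)
      have "geodesic_on {0..dist x (\<gamma> (r n))} (c (r n))" "c (r n) 0 = x"
        "c (r n) (dist x (\<gamma> (r n))) = \<gamma> (r n)"
        using c[of "r n"] by (auto simp: gromov_arc_def geodesic_segment_def u_def)
      then show ?case
        using fellow_travel[OF geodesic_rays_on[OF \<gamma>], of "dist x (\<gamma> (r n))" "c (r n)" t "real (r n)"]
          elim t far[of "r n"] delta_nonneg zero_le_dist[of x "\<gamma> 0"] by auto
    qed
  qed simp
  then have "asymptotic \<gamma> g" unfolding asymptotic_iff by blast
  with g show ?thesis by blast
qed

lemma gromov_arc_exists:
  assumes "z \<in> gromov_points"
  shows "\<exists>c. gromov_arc (x::'a) z c"
proof (cases z)
  case (Inl w)
  then show ?thesis using gromov_arc_interior_exists by simp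
next
  case (Inr \<xi>)
  then have \<xi>: "\<xi> \<in> gromov_boundary" using assms by (auto simp: gromov_points_def)
  then obtain \<gamma> where \<gamma>: "\<gamma> \<in> \<xi>" using gromov_boundary_nonempty by blast
  then obtain \<tau> where "\<tau> \<in> geodesic_rays" "\<tau> 0 = x" "asymptotic \<gamma> \<tau>"
    using asymptotic_ray_exists gromov_boundary_rays \<xi> by metis
  then have "\<tau> \<in> \<xi>" "\<tau> 0 = x"
    using gromov_boundary_mem_iff[OF \<xi> \<gamma>] by blast+
  then show ?thesis
    unfolding Inr gromov_arc_def by (intro exI[of _ \<tau>]) simp
qed

end

section \<open>Busemann functions\<close>

text \<open>For each \<open>w\<close> the function d(w, \<gamma>(t)) - t is decreasing and bounded
  below by -d(w, \<gamma>(0)), hence convergent. The term t cancels in the difference for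
  \<open>x\<close> and \<open>y\<close>.\<close>

lemma busemann_tendsto:
  assumes \<gamma>: "\<gamma> \<in> geodesic_rays"
  shows "((\<lambda>t. dist x (\<gamma> t) - dist (\<gamma> t) y) \<longlongrightarrow> busemann \<gamma> x y) at_top"
proof -
  have conv: "\<exists>L. ((\<lambda>t. dist w (\<gamma> t) - t) \<longlongrightarrow> L) at_top" for w
  proof -
    define f where "f t = dist w (\<gamma> t) - t" for t
    have anti: "f t \<le> f s" if "0 \<le> s" "s \<le> t" for s t
      using geodesic_rays_dist[OF \<gamma>, of s t] dist_triangle[of w "\<gamma> t" "\<gamma> s"] that
      by (simp add: f_def)
    have low: "- dist w (\<gamma> 0) \<le> f t" if "0 \<le> t" for t
      using geodesic_rays_dist[OF \<gamma>, of 0 t] dist_triangle[of "\<gamma> 0" "\<gamma> t" w] that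
      by (simp add: f_def dist_commute)
    then have bdd: "bdd_below (f ` {0..})"
      by (auto intro!: bdd_belowI)
    have "(f \<longlongrightarrow> Inf (f ` {0..})) at_top"
    proof (rule order_tendstoI)
      fix a assume "a < Inf (f ` {0..})"
      then have "a < f t" if "0 \<le> t" for t
        using cINF_lower[OF bdd, of t] that by fastforce
      then show "\<forall>\<^sub>F t in at_top. a < f t"
        by (rule eventually_mono[OF eventually_ge_at_top[of 0]])
    next
      fix a assume "Inf (f ` {0..}) < a"
      then obtain s where s: "0 \<le> s" "f s < a"
        using cInf_less_iff[OF _ bdd] by auto
      show "\<forall>\<^sub>F t in at_top. f t < a"
        using eventually_ge_at_top[of s]
      proof eventually_elim
        case (elim t)
        then show ?case using anti[of s t] s by simp
      qed
    qed
    then show ?thesis unfolding f_def by blast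
  qed
  obtain L M where "((\<lambda>t. dist x (\<gamma> t) - t) \<longlongrightarrow> L) at_top" "((\<lambda>t. dist y (\<gamma> t) - t) \<longlongrightarrow> M) at_top"
    using conv by blast
  then have "((\<lambda>t. (dist x (\<gamma> t) - t) - (dist y (\<gamma> t) - t)) \<longlongrightarrow> L - M) at_top"
    by (rule tendsto_diff)
  then have *: "((\<lambda>t. dist x (\<gamma> t) - dist (\<gamma> t) y) \<longlongrightarrow> L - M) at_top"
    by (simp add: dist_commute)
  then have "busemann \<gamma> x y = L - M"
    unfolding busemann_def by (intro tendsto_Lim) simp
  with * show ?thesis by simp
qed

lemma busemann_unique:
  assumes "\<gamma> \<in> geodesic_rays" "((\<lambda>t. dist x (\<gamma> t) - dist (\<gamma> t) y) \<longlongrightarrow> L) at_top"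
  shows "busemann \<gamma> x y = L"
  using tendsto_unique[OF _ busemann_tendsto[OF assms(1)] assms(2)] by simp

lemma busemann_add:
  assumes "\<gamma> \<in> geodesic_rays"
  shows "busemann \<gamma> x y + busemann \<gamma> y z = busemann \<gamma> x z"
  using busemann_unique[OF assms, of x z "busemann \<gamma> x y + busemann \<gamma> y z"]
    tendsto_add[OF busemann_tendsto[OF assms, of x y] busemann_tendsto[OF assms, of y z]]
  by (simp add: dist_commute)

lemma busemann_abs_le:
  assumes "\<gamma> \<in> geodesic_rays" shows "\<bar>busemann \<gamma> x y\<bar> \<le> dist x y"
proof (rule tendsto_upperbound)
  show "((\<lambda>t. \<bar>dist x (\<gamma> t) - dist (\<gamma> t) y\<bar>) \<longlongrightarrow> \<bar>busemann \<gamma> x y\<bar>) at_top"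
    by (intro tendsto_rabs busemann_tendsto assms)
  show "\<forall>\<^sub>F t in at_top. \<bar>dist x (\<gamma> t) - dist (\<gamma> t) y\<bar> \<le> dist x y"
  proof (rule always_eventually, rule allI)
    fix t
    show "\<bar>dist x (\<gamma> t) - dist (\<gamma> t) y\<bar> \<le> dist x y"
      using dist_triangle[of x "\<gamma> t" y] dist_triangle[of y "\<gamma> t" x]
      by (simp add: dist_commute)
  qed
qed simp

lemma busemann_along_ray:
  assumes "\<gamma> \<in> geodesic_rays" "0 \<le> t"
  shows "busemann \<gamma> (\<gamma> t) (\<gamma> 0) = - t"
proof (rule busemann_unique[OF assms(1)], rule tendsto_eventually)
  show "\<forall>\<^sub>F s in at_top. dist (\<gamma> t) (\<gamma> s) - dist (\<gamma> s) (\<gamma> 0) = - t"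
    using eventually_ge_at_top[of t]
    by eventually_elim (use geodesic_rays_dist[OF assms(1)] assms(2) in simp)
qed

text \<open>The time shift does not affect a limit at infinity, and replacing
  \<open>\<gamma> t\<close> by \<open>\<sigma> (t + T)\<close> changes each of the two distances by
  at most their vanishing distance.\<close>

lemma busemann_strongly_asymptotic:
  assumes "\<gamma> \<in> geodesic_rays" "\<sigma> \<in> geodesic_rays" "strongly_asymptotic \<gamma> \<sigma>"
  shows "busemann \<gamma> x y = busemann \<sigma> x y"
proof -
  obtain T where T: "((\<lambda>t. dist (\<gamma> t) (\<sigma> (t + T))) \<longlongrightarrow> 0) at_top"
    using assms(3) by (auto simp: strongly_asymptotic_def)
  have "filterlim (\<lambda>t. t + T) at_top (at_top :: real filter)"
    using filterlim_tendsto_add_at_top[OF tendsto_const filterlim_ident, of T]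
    by (simp add: add.commute)
  then have *: "((\<lambda>t. dist x (\<sigma> (t + T)) - dist (\<sigma> (t + T)) y) \<longlongrightarrow> busemann \<sigma> x y) at_top"
    by (rule filterlim_compose[OF busemann_tendsto[OF assms(2)]])
  have 0: "((\<lambda>t. (dist x (\<gamma> t) - dist (\<gamma> t) y) -
      (dist x (\<sigma> (t + T)) - dist (\<sigma> (t + T)) y)) \<longlongrightarrow> 0) at_top"
  proof (rule Lim_null_comparison)
    show "((\<lambda>t. 2 * dist (\<gamma> t) (\<sigma> (t + T))) \<longlongrightarrow> 0) at_top"
      using tendsto_mult[OF tendsto_const T, of 2] by simp
    show "\<forall>\<^sub>F t in at_top. norm ((dist x (\<gamma> t) - dist (\<gamma> t) y) -
        (dist x (\<sigma> (t + T)) - dist (\<sigma> (t + T)) y)) \<le> 2 * dist (\<gamma> t) (\<sigma> (t + T))"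
    proof (rule always_eventually, rule allI)
      fix t
      show "norm ((dist x (\<gamma> t) - dist (\<gamma> t) y) -
        (dist x (\<sigma> (t + T)) - dist (\<sigma> (t + T)) y)) \<le> 2 * dist (\<gamma> t) (\<sigma> (t + T))"
        using dist_triangle[of x "\<gamma> t" "\<sigma> (t + T)"] dist_triangle[of x "\<sigma> (t + T)" "\<gamma> t"]
          dist_triangle[of y "\<gamma> t" "\<sigma> (t + T)"] dist_triangle[of y "\<sigma> (t + T)" "\<gamma> t"]
        by (simp add: dist_commute abs_le_iff)
    qed
  qed
  show ?thesis
    using busemann_unique[OF assms(1)] tendsto_add[OF 0 *] by simp
qed

text \<open>Both base points are kept as arguments so that the cocycle identity
  \<open>horofunction_add\<close> can split a value along a path through intermediate points. The
  normalised functions are those with second argument \<open>p\<close>. The choice of the ray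
  becomes immaterial in \<open>horofunction_boundary\<close>.\<close>

definition horofunction :: "'a::metric_space gromov_point \<Rightarrow> 'a \<Rightarrow> 'a \<Rightarrow> real" where
  "horofunction z x y = (case z of
      Inl w \<Rightarrow> dist x w - dist y w | Inr \<xi> \<Rightarrow> busemann (SOME \<gamma>. \<gamma> \<in> \<xi>) x y)"

lemma gromov_boundary_some:
  assumes "\<xi> \<in> gromov_boundary"
  shows "(SOME \<gamma>. \<gamma> \<in> \<xi>) \<in> \<xi>" "(SOME \<gamma>. \<gamma> \<in> \<xi>) \<in> geodesic_rays"
proof -
  show "(SOME \<gamma>. \<gamma> \<in> \<xi>) \<in> \<xi>"
    using gromov_boundary_nonempty[OF assms] by (rule someI_ex)
  then show "(SOME \<gamma>. \<gamma> \<in> \<xi>) \<in> geodesic_rays"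
    by (rule gromov_boundary_rays[OF assms])
qed

lemma Inr_in_gromov_points [simp]: "Inr \<xi> \<in> gromov_points \<longleftrightarrow> \<xi> \<in> gromov_boundary"
  by (auto simp: gromov_points_def)

lemma Inl_in_gromov_points [simp]: "Inl x \<in> gromov_points"
  by (auto simp: gromov_points_def)

lemma horofunction_add:
  assumes "z \<in> gromov_points"
  shows "horofunction z x y + horofunction z y w = horofunction z x w"
proof (cases z)
  case (Inr \<xi>)
  then show ?thesis
    using assms busemann_add[OF gromov_boundary_some(2)] by (simp add: horofunction_def)
qed (simp add: horofunction_def)

lemma horofunction_refl: "z \<in> gromov_points \<Longrightarrow> horofunction z x x = 0"
  using horofunction_add[of z x x x] by simp

lemma horofunction_abs_le:
  assumes "z \<in> gromov_points"
  shows "\<bar>horofunction z x y\<bar> \<le> dist x y"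
proof (cases z)
  case (Inl w)
  then show ?thesis
    using dist_triangle[of x w y] dist_triangle[of y w x]
    by (simp add: horofunction_def dist_commute abs_le_iff)
next
  case (Inr \<xi>)
  then show ?thesis
    using assms busemann_abs_le[OF gromov_boundary_some(2)] by (simp add: horofunction_def)
qed

section \<open>Horofunctions and limits of arcs\<close>

locale approaching_geodesics_space = slim_proper_geodesic_space \<delta> p
  for \<delta> and p :: "'a::metric_space" +
  assumes approaching: "approaching_geodesics TYPE('a)"
begin

lemma busemann_asymptotic:
  assumes "\<gamma> \<in> geodesic_rays" "\<sigma> \<in> geodesic_rays" "asymptotic \<gamma> (\<sigma> :: real \<Rightarrow> 'a)"
  shows "busemann \<gamma> x y = busemann \<sigma> x y"
  using approaching assms busemann_strongly_asymptotic unfolding approaching_geodesics_def by blast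

lemma horofunction_boundary:
  assumes "\<xi> \<in> gromov_boundary" "(\<gamma> :: real \<Rightarrow> 'a) \<in> \<xi>"
  shows "horofunction (Inr \<xi>) = busemann \<gamma>"
proof (intro ext)
  fix x y
  have "asymptotic \<gamma> (SOME \<gamma>. \<gamma> \<in> \<xi>)"
    using gromov_boundary_mem_iff[OF assms] gromov_boundary_some(1)[OF assms(1)] by simp
  then show "horofunction (Inr \<xi>) x y = busemann \<gamma> x y"
    using busemann_asymptotic[of \<gamma> "SOME \<gamma>. \<gamma> \<in> \<xi>"] gromov_boundary_rays[OF assms]
      gromov_boundary_some(2)[OF assms(1)] by (simp add: horofunction_def)
qed

text \<open>For an interior end this is additivity of distances along the segment, with a constant
  value once the end is reached. For a boundary end the arc is itself a representative of the class
  and may define the Busemann function.\<close>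

lemma horofunction_along_arc:
  assumes "z \<in> gromov_points" "gromov_arc (x::'a) z c" "0 \<le> t"
  shows "horofunction z (c t) x = - arc_time x z t"
proof (cases z)
  case (Inl w)
  then have "c (dist x w) = w"
    using assms(2) by (simp add: gromov_arc_def)
  then show ?thesis
    using gromov_arc_dist[OF assms(1,2), of t "dist x w"] assms(3) Inl
    by (simp add: horofunction_def arc_time_def min_def split: if_splits)
next
  case (Inr \<xi>)
  then have c: "\<xi> \<in> gromov_boundary" "c \<in> \<xi>" "c 0 = x"
    using assms by (auto simp: gromov_arc_def)
  show ?thesis
    using busemann_along_ray[OF gromov_boundary_rays[OF c(1,2)] assms(3)]
    by (simp add: Inr horofunction_boundary[OF c(1,2)] arc_time_def c(3))
qed

text \<open>Since the limit is a ray, the arcs must cover arbitrarily large distances from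
  \<open>x\<close>; passing to the base point \<open>y\<close> costs at most
  \<open>dist x y\<close>.\<close>

lemma arc_time_eventually_id:
  assumes u: "\<And>n. u n \<in> gromov_points"
    and c: "\<And>n. gromov_arc (x::'a) (u n) (c n)"
    and lim: "\<And>t. 0 \<le> t \<Longrightarrow> (\<lambda>n. c n t) \<longlonglongrightarrow> g t"
    and g: "g \<in> geodesic_rays" and t: "0 \<le> t"
  shows "\<forall>\<^sub>F n in sequentially. arc_time y (u n) t = t"
proof -
  \<comment> \<open>The term \<open>dist x y\<close> pays for the change of base point. The arcs are
    evaluated at \<open>s + 1\<close> so that the limiting distance exceeds \<open>s\<close>
    strictly.\<close>
  define s where "s = t + dist x y + 1"
  have s: "0 \<le> s + 1" "t + dist x y < s" using t by (simp_all add: s_def)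
  have "(\<lambda>n. dist (c n 0) (c n (s + 1))) \<longlonglongrightarrow> dist (g 0) (g (s + 1))"
    using s by (intro tendsto_dist lim) auto
  moreover have "dist (g 0) (g (s + 1)) = s + 1"
    using geodesic_rays_dist[OF g, of 0 "s + 1"] s by simp
  ultimately have "\<forall>\<^sub>F n in sequentially. s < dist (c n 0) (c n (s + 1))"
    by (intro order_tendstoD(1)) auto
  then show ?thesis
  proof eventually_elim
    case (elim n)
    have "arc_time x (u n) 0 = 0" by (auto simp: arc_time_def split: sum.split)
    then have "s < \<bar>arc_time x (u n) (s + 1)\<bar>"
      using elim gromov_arc_dist[OF u c, of 0 "s + 1" n] s by simp
    moreover have "0 \<le> arc_time x (u n) (s + 1)"
      using s by (auto simp: arc_time_def split: sum.split)
    ultimately have "t < arc_time y (u n) (s + 1)"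
      using s arc_time_change_base[of x "u n" "s + 1" y] by simp
    then show ?case by (auto simp: arc_time_def split: sum.splits)
  qed
qed

text \<open>The arcs from the two base points converge to asymptotic, hence approaching, rays;
  following one arc, jumping to the other and returning evaluates both horofunctions up to
  the length of the jump.\<close>

lemma horofunction_tendsto_busemann_aux:
  assumes u: "\<And>n. u n \<in> gromov_points"
    and c: "\<And>n. gromov_arc (x::'a) (u n) (c n)" and c': "\<And>n. gromov_arc y (u n) (c' n)"
    and lim: "\<And>t. 0 \<le> t \<Longrightarrow> (\<lambda>n. c n t) \<longlonglongrightarrow> g t"
    and lim': "\<And>t. 0 \<le> t \<Longrightarrow> (\<lambda>n. c' n t) \<longlonglongrightarrow> g' t"
    and g: "g \<in> geodesic_rays"
  shows "(\<lambda>n. horofunction (u n) y x) \<longlonglongrightarrow> busemann g y x"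
proof (rule tendstoI)
  fix e :: real assume e: "0 < e"
  have long: "\<forall>\<^sub>F n in sequentially. arc_time w (u n) t = t" if "0 \<le> t" for w t
    using arc_time_eventually_id[where u = u and c = c, OF u c lim g that] by simp
  have g0: "g 0 = x" using gromov_arcs_limit_ray(2)[OF u c lim long] by simp
  have g': "g' \<in> geodesic_rays" "g' 0 = y"
    using gromov_arcs_limit_ray[OF u c' lim' long] by auto
  have "dist (g t) (g' t) \<le> 4 * \<delta> + 3 * dist x y" if t: "0 \<le> t" for t
  proof (rule tendsto_upperbound)
    show "(\<lambda>n. dist (c n t) (c' n t)) \<longlonglongrightarrow> dist (g t) (g' t)"
      using t by (intro tendsto_dist lim lim')
    have "0 \<le> t + 2 * \<delta> + 1" using t delta_nonneg by simp
    then have "\<forall>\<^sub>F n in sequentially. arc_time x (u n) (t + 2 * \<delta> + 1) = t + 2 * \<delta> + 1"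
      by (rule long)
    then show "\<forall>\<^sub>F n in sequentially. dist (c n t) (c' n t) \<le> 4 * \<delta> + 3 * dist x y"
      using long[OF t, of y]
      by eventually_elim (rule gromov_arcs_fellow_travel[OF u c c' t])
  qed simp
  then have asym: "asymptotic g g'" unfolding asymptotic_iff by blast
  then obtain T where T: "((\<lambda>t. dist (g t) (g' (t + T))) \<longlongrightarrow> 0) at_top"
    using approaching g g'(1) unfolding approaching_geodesics_def strongly_asymptotic_def by blast
  have "\<forall>\<^sub>F t in at_top. dist (dist (g t) (g' (t + T))) 0 < e / 4 \<and> \<bar>T\<bar> \<le> t"
    using tendstoD[OF T, of "e / 4"] e by (intro eventually_conj eventually_ge_at_top) auto
  \<comment> \<open>One time \<open>t\<close> is fixed at which the jump between the limit rays is
    short and both parameters \<open>t\<close> and \<open>t + T\<close> are nonnegative.\<close>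
  then obtain t where t: "dist (g t) (g' (t + T)) < e / 4" "\<bar>T\<bar> \<le> t"
    using eventually_happens'[OF trivial_limit_at_top_linorder] by fastforce
  then have t0: "0 \<le> t" "0 \<le> t + T" by auto
  have "busemann g y x = busemann g y (g' (t + T)) + busemann g (g' (t + T)) (g t) + busemann g (g t) x"
    by (simp add: busemann_add[OF g])
  \<comment> \<open>The rays \<open>g\<close> and \<open>g'\<close> define the same Busemann
    function, so its change along \<open>g'\<close> is known although it is written with
    \<open>g\<close>.\<close>
  moreover have "busemann g y (g' (t + T)) = t + T"
    using busemann_along_ray[OF g'(1) t0(2)] busemann_add[OF g'(1), of y "g' (t + T)" y]
      busemann_add[OF g'(1), of y y y] busemann_asymptotic[OF g g'(1) asym] g'(2) by simp
  moreover have "busemann g (g t) x = - t"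
    using busemann_along_ray[OF g t0(1)] g0 by simp
  moreover have "\<bar>busemann g (g' (t + T)) (g t)\<bar> < e / 4"
    using busemann_abs_le[OF g, of "g' (t + T)" "g t"] t(1) by (simp add: dist_commute)
  ultimately have B: "\<bar>busemann g y x - T\<bar> < e / 4" by linarith
  \<comment> \<open>With \<open>t\<close> fixed, pointwise convergence of the arcs at two times
    suffices for the same three-leg estimate. Both values are then within e/4 of
    \<open>T\<close>.\<close>
  have "(\<lambda>n. dist (c n t) (c' n (t + T))) \<longlonglongrightarrow> dist (g t) (g' (t + T))"
    using t0 by (intro tendsto_dist lim lim')
  then have "\<forall>\<^sub>F n in sequentially. dist (c n t) (c' n (t + T)) < e / 4"
    using t(1) by (rule order_tendstoD(2))
  then show "\<forall>\<^sub>F n in sequentially. dist (horofunction (u n) y x) (busemann g y x) < e"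
    using long[OF t0(1), of x] long[OF t0(2), of y]
  proof eventually_elim
    case (elim n)
    have "horofunction (u n) y x = horofunction (u n) y (c' n (t + T)) +
        horofunction (u n) (c' n (t + T)) (c n t) + horofunction (u n) (c n t) x"
      by (simp add: horofunction_add[OF u])
    moreover have "horofunction (u n) y (c' n (t + T)) = t + T"
      using horofunction_along_arc[OF u c' t0(2), of n] elim(3)
        horofunction_add[OF u, of n y "c' n (t + T)" y] horofunction_refl[OF u, of n y] by simp
    moreover have "horofunction (u n) (c n t) x = - t"
      using horofunction_along_arc[OF u c t0(1), of n] elim(2) by simp
    moreover have "\<bar>horofunction (u n) (c' n (t + T)) (c n t)\<bar> < e / 4"
      using horofunction_abs_le[OF u, of n "c' n (t + T)" "c n t"] elim(1) by (simp add: dist_commute)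
    ultimately have "\<bar>horofunction (u n) y x - T\<bar> < e / 4" by linarith
    with B e show ?case unfolding dist_real_def by linarith
  qed
qed

text \<open>Convergence of the arcs from \<open>y\<close> can be assumed after passing to a
  subsequence. As the limit value \<open>busemann g y x\<close> is the same for every such
  subsequence, the whole sequence converges.\<close>

lemma horofunction_tendsto_busemann:
  assumes u: "\<And>n. u n \<in> gromov_points"
    and c: "\<And>n. gromov_arc (x::'a) (u n) (c n)"
    and lim: "\<And>t. 0 \<le> t \<Longrightarrow> (\<lambda>n. c n t) \<longlonglongrightarrow> g t"
    and g: "g \<in> geodesic_rays"
  shows "(\<lambda>n. horofunction (u n) y x) \<longlonglongrightarrow> busemann g y x"
proof (rule ccontr)
  assume "\<not> ?thesis"
  then obtain e where e: "0 < e"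
    and "\<not> (\<forall>\<^sub>F n in sequentially. dist (horofunction (u n) y x) (busemann g y x) < e)"
    unfolding tendsto_iff by blast
  then obtain r :: "nat \<Rightarrow> nat" where r: "strict_mono r"
    and far: "\<And>n. \<not> dist (horofunction (u (r n)) y x) (busemann g y x) < e"
    using not_eventually_sequentiallyD by blast
  have "\<forall>n. \<exists>c'. gromov_arc y (u (r n)) c'"
    using gromov_arc_exists u by blast
  then obtain c' where c': "\<And>n. gromov_arc y (u (r n)) (c' n)" by metis
  obtain s :: "nat \<Rightarrow> nat" and g' where s: "strict_mono s"
    and lim': "\<And>t. 0 \<le> t \<Longrightarrow> (\<lambda>n. c' (s n) t) \<longlonglongrightarrow> g' t"
    by (rule gromov_arcs_subsequence[where c = c', OF u c']) (rule that)
  have "(\<lambda>n. c (r (s n)) t) \<longlonglongrightarrow> g t" if "0 \<le> t" for t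
    using LIMSEQ_subseq_LIMSEQ[OF lim[OF that] strict_mono_o[OF r s]] by (simp add: o_def)
  then have "(\<lambda>n. horofunction (u (r (s n))) y x) \<longlonglongrightarrow> busemann g y x"
    using u c c' lim' g
    by (intro horofunction_tendsto_busemann_aux[where c = "\<lambda>n. c (r (s n))" and c' = "\<lambda>n. c' (s n)"])
  then have "\<forall>\<^sub>F n in sequentially. dist (horofunction (u (r (s n))) y x) (busemann g y x) < e"
    using e by (rule tendstoD)
  then show False using far by simp
qed

text \<open>At a boundary limit, any subsequence has a further one along which the arcs from
  \<open>p\<close> converge. Gromov convergence places their limit in \<open>\<xi>\<close>, and all
  rays of \<open>\<xi>\<close> have the same Busemann function.\<close>

lemma gromov_converges_imp_horofunction_tendsto:
  assumes u: "\<And>n. u n \<in> gromov_points" and z: "z \<in> gromov_points"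
    and conv: "gromov_converges p u z"
  shows "(\<lambda>n. horofunction (u n) y p) \<longlonglongrightarrow> horofunction z y p"
proof (cases z)
  case (Inl x)
  then obtain v where v: "\<forall>\<^sub>F n in sequentially. u n = Inl (v n)" "v \<longlonglongrightarrow> x"
    using conv by (auto simp: gromov_converges_def)
  have "(\<lambda>n. dist y (v n) - dist p (v n)) \<longlonglongrightarrow> dist y x - dist p x"
    by (intro tendsto_intros v)
  moreover have "\<forall>\<^sub>F n in sequentially. dist y (v n) - dist p (v n) = horofunction (u n) y p"
    using v(1) by eventually_elim (simp add: horofunction_def)
  ultimately show ?thesis
    by (simp add: Inl horofunction_def[of "Inl x"] Lim_transform_eventually)
next
  case (Inr \<xi>)
  then have \<xi>: "\<xi> \<in> gromov_boundary" using z by simp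
  have "\<forall>n. \<exists>c. gromov_arc p (u n) c"
    using gromov_arc_exists u by blast
  then obtain c where c: "\<And>n. gromov_arc p (u n) (c n)" by metis
  show ?thesis
  proof (rule ccontr)
    assume "\<not> ?thesis"
    then obtain e where e: "0 < e"
      and "\<not> (\<forall>\<^sub>F n in sequentially. dist (horofunction (u n) y p) (horofunction z y p) < e)"
      unfolding tendsto_iff by blast
    then obtain r :: "nat \<Rightarrow> nat" where r: "strict_mono r"
      and far: "\<And>n. \<not> dist (horofunction (u (r n)) y p) (horofunction z y p) < e"
      using not_eventually_sequentiallyD by blast
    obtain s :: "nat \<Rightarrow> nat" and g where s: "strict_mono s"
      and unif: "\<And>T. uniform_limit {0..T} (\<lambda>n. c (r (s n))) g sequentially"
      and lim: "\<And>t. 0 \<le> t \<Longrightarrow> (\<lambda>n. c (r (s n)) t) \<longlonglongrightarrow> g t"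
      by (rule gromov_arcs_subsequence[where c = "\<lambda>n. c (r n)", OF u c]) (rule that)
    have "strict_mono (\<lambda>n. r (s n))" using strict_mono_o[OF r s] by (simp add: o_def)
    then have g: "g \<in> \<xi>"
      using conv c unif unfolding gromov_converges_def Inr by (auto dest!: spec[of _ c])
    then have "(\<lambda>n. horofunction (u (r (s n))) y p) \<longlonglongrightarrow> horofunction z y p"
      unfolding Inr horofunction_boundary[OF \<xi> g]
      by (intro horofunction_tendsto_busemann[where c = "\<lambda>n. c (r (s n))"] u c lim
          gromov_boundary_rays[OF \<xi> g])
    then have "\<forall>\<^sub>F n in sequentially. dist (horofunction (u (r (s n))) y p) (horofunction z y p) < e"
      using e by (rule tendstoD)
    then show False using far by simp
  qed
qed

text \<open>The descent means that for large \<open>s\<close> the detour to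
  \<open>\<gamma> s\<close> through \<open>\<sigma> t\<close> exceeds a geodesic by less than 1. In
  the triangle with vertices \<open>\<sigma> 0\<close>, \<open>\<gamma> s\<close>,
  \<open>\<sigma> t\<close>, the point \<open>\<gamma> t\<close> is \<delta>-close to one of the
  other sides. Comparing lengths then brings it within 2\<delta> + 1 of \<open>\<sigma> t\<close>,
  the 1 being the error of the detour.\<close>

lemma asymptotic_if_busemann_descends:
  fixes \<gamma> \<sigma> :: "real \<Rightarrow> 'a"
  assumes \<gamma>: "\<gamma> \<in> geodesic_rays" and \<sigma>: "\<sigma> \<in> geodesic_rays" and 0: "\<gamma> 0 = \<sigma> 0"
    and desc: "\<And>t. 0 \<le> t \<Longrightarrow> busemann \<gamma> (\<sigma> t) (\<sigma> 0) = - t"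
  shows "asymptotic \<gamma> \<sigma>"
proof -
  have "dist (\<gamma> t) (\<sigma> t) \<le> 2 * \<delta> + 1" if t: "0 \<le> t" for t
  proof -
    have "\<forall>\<^sub>F s in at_top. dist (\<sigma> t) (\<gamma> s) - dist (\<gamma> s) (\<sigma> 0) < - t + 1 \<and> t \<le> s"
      using order_tendstoD(2)[OF busemann_tendsto[OF \<gamma>, of "\<sigma> t" "\<sigma> 0"]] desc[OF t]
      by (intro eventually_conj eventually_ge_at_top) auto
    then obtain s where s: "dist (\<sigma> t) (\<gamma> s) - dist (\<gamma> s) (\<sigma> 0) < - t + 1" "t \<le> s"
      using eventually_happens'[OF trivial_limit_at_top_linorder] by fastforce
    have ds: "dist (\<gamma> s) (\<sigma> 0) = s" "dist (\<gamma> t) (\<gamma> s) = s - t"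
      using geodesic_rays_dist[OF \<gamma>, of s 0] geodesic_rays_dist[OF \<gamma>, of t s] 0 s t by auto
    obtain D where D: "D \<in> geodesic_sides (\<gamma> s) (\<sigma> t)" using sides_nonempty by blast
    have S: "\<gamma> ` {0..s} \<in> geodesic_sides (\<sigma> 0) (\<gamma> s)"
      using image_in_geodesic_sides[OF geodesic_rays_on[OF \<gamma>], of s] s t 0 by simp
    have S': "\<sigma> ` {0..t} \<in> geodesic_sides (\<sigma> t) (\<sigma> 0)"
      using image_in_geodesic_sides[OF geodesic_rays_on[OF \<sigma>], of t] t geodesic_sides_commute by auto
    have "\<gamma> t \<in> \<gamma> ` {0..s}" using t s by auto
    from slim[OF S D S' this] obtain b where b: "b \<in> D \<union> \<sigma> ` {0..t}" "dist (\<gamma> t) b \<le> \<delta>" by blast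
    show ?thesis
    proof (cases "b \<in> D")
      case True
      then have "dist (\<gamma> s) b + dist b (\<sigma> t) = dist (\<gamma> s) (\<sigma> t)"
        by (rule geodesic_sides_dist[OF D])
      moreover have "s - t \<le> \<delta> + dist (\<gamma> s) b"
        using ds(2) b(2) dist_triangle[of "\<gamma> t" "\<gamma> s" b] by (simp add: dist_commute)
      ultimately show ?thesis
        using s(1) ds(1) b(2) dist_triangle[of "\<gamma> t" "\<sigma> t" b] by (simp add: dist_commute)
    next
      case False
      then obtain r where r: "b = \<sigma> r" "0 \<le> r" "r \<le> t" using b(1) by auto
      have "dist (\<gamma> 0) (\<gamma> t) = t" "dist (\<sigma> 0) (\<sigma> r) = r" "dist (\<sigma> r) (\<sigma> t) = t - r"
        using geodesic_rays_dist[OF \<gamma>, of 0 t] geodesic_rays_dist[OF \<sigma>] r t by auto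
      then show ?thesis
        using b(2) r 0 dist_triangle[of "\<gamma> t" "\<sigma> t" "\<sigma> r"] dist_triangle[of "\<gamma> 0" "\<gamma> t" "\<sigma> r"]
        by (simp add: dist_commute)
    qed
  qed
  then show ?thesis unfolding asymptotic_iff by blast
qed

text \<open>At an interior limit \<open>x\<close>, suppose that \<open>u n\<close> lies outside the
  ball of radius \<open>e\<close> about \<open>x\<close>. From \<open>x\<close> to the point at
  distance \<open>e\<close> on the arc to \<open>u n\<close>, its horofunction falls by
  \<open>e\<close> while that of \<open>x\<close> rises by \<open>e\<close>. Two errors below e/2
  cannot account for the gap 2e.\<close>

lemma uniform_horofunction_limit_imp_gromov_converges:
  assumes u: "\<And>n. u n \<in> gromov_points" and z: "z \<in> gromov_points"
    and unif: "\<And>K. compact K \<Longrightarrow>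
      uniform_limit K (\<lambda>n y. horofunction (u n) y p) (\<lambda>y. horofunction z y p) sequentially"
  shows "gromov_converges p u z"
proof (cases z)
  case (Inl x)
  have close: "\<forall>\<^sub>F n in sequentially. \<exists>w. u n = Inl w \<and> dist w x < e" if e: "0 < e" for e
  proof -
    \<comment> \<open>The test point \<open>c e\<close> below depends on \<open>n\<close> and is
      only known to lie in this ball, so pointwise convergence would not be enough.\<close>
    have "compact (cball x e)" using proper by (simp add: proper_space_def)
    from uniform_limitD[OF unif[OF this], of "e / 2"] e
    have "\<forall>\<^sub>F n in sequentially. \<forall>y\<in>cball x e.
        dist (horofunction (u n) y p) (horofunction z y p) < e / 2" by simp
    then show ?thesis
    proof eventually_elim
      case (elim n)
      show ?case
      proof (rule ccontr)
        assume no: "\<not> ?thesis"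
        then have time: "arc_time x (u n) e = e"
          by (cases "u n") (auto simp: arc_time_def dist_commute)
        obtain c where c: "gromov_arc x (u n) c" using gromov_arc_exists[OF u] by blast
        have "arc_time x (u n) 0 = 0" using e by (auto simp: arc_time_def split: sum.split)
        then have d: "dist x (c e) = e"
          using gromov_arc_dist[OF u c, of 0 e] gromov_arc_start[OF c] e time by simp
        then have "dist (horofunction (u n) (c e) p) (horofunction z (c e) p) < e / 2"
          "dist (horofunction (u n) x p) (horofunction z x p) < e / 2"
          using elim e by auto
        moreover have "horofunction (u n) (c e) p - horofunction (u n) x p = - e"
          using horofunction_along_arc[OF u c, of e] horofunction_add[OF u, of n "c e" x p] e time by simp
        moreover have "horofunction z (c e) p - horofunction z x p = e"
          using d by (simp add: Inl horofunction_def dist_commute)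
        ultimately show False using e unfolding dist_real_def by linarith
      qed
    qed
  qed
  define v where "v n = (case u n of Inl w \<Rightarrow> w | Inr _ \<Rightarrow> x)" for n
  have "\<forall>\<^sub>F n in sequentially. u n = Inl (v n)"
    using close[OF zero_less_one] by eventually_elim (auto simp: v_def)
  moreover have "v \<longlonglongrightarrow> x"
  proof (rule tendstoI)
    fix e :: real assume "0 < e"
    from close[OF this] show "\<forall>\<^sub>F n in sequentially. dist (v n) x < e"
      by eventually_elim (auto simp: v_def)
  qed
  ultimately show ?thesis
    unfolding gromov_converges_def Inl by auto
next
  case (Inr \<xi>)
  then have \<xi>: "\<xi> \<in> gromov_boundary" using z by simp
  obtain \<gamma> where \<gamma>: "gromov_arc p z \<gamma>" using gromov_arc_exists[OF z] by blast
  then have \<gamma>': "\<gamma> \<in> \<xi>" "\<gamma> 0 = p" "\<gamma> \<in> geodesic_rays"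
    using gromov_boundary_rays[OF \<xi>] by (auto simp: Inr gromov_arc_def)
  note hz = horofunction_boundary[OF \<xi> \<gamma>'(1)]
  have pt: "(\<lambda>n. horofunction (u n) y p) \<longlonglongrightarrow> busemann \<gamma> y p" for y
    using tendsto_uniform_limitI[OF unif[of "{y}"], of y] by (simp add: Inr hz)
  \<comment> \<open>The limit function reaches the value -(t + 1) at
    \<open>\<gamma> (t + 1)\<close>, whereas the horofunction of an interior point \<open>w\<close>
    is never below -d(p, w). Hence the points \<open>u n\<close> leave every ball about
    \<open>p\<close>.\<close>
  have long: "\<forall>\<^sub>F n in sequentially. arc_time p (u n) t = t" if t: "0 \<le> t" for t
  proof -
    have "(\<lambda>n. horofunction (u n) (\<gamma> (t + 1)) p) \<longlonglongrightarrow> - (t + 1)"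
      using pt[of "\<gamma> (t + 1)"] busemann_along_ray[OF \<gamma>'(3), of "t + 1"] \<gamma>'(2) t by simp
    then have "\<forall>\<^sub>F n in sequentially. horofunction (u n) (\<gamma> (t + 1)) p < - t"
      by (rule order_tendstoD(2)) simp
    then show ?thesis
    proof eventually_elim
      case (elim n)
      show ?case
      proof (cases "u n")
        case (Inl w)
        then show ?thesis
          using elim zero_le_dist[of "\<gamma> (t + 1)" w] unfolding horofunction_def arc_time_def
          by (simp del: zero_le_dist)
      qed (simp add: arc_time_def)
    qed
  qed
  have "g \<in> \<xi>" if c: "\<And>n. gromov_arc p (u n) (c n)" and r: "strict_mono r"
    and lim: "\<And>T. uniform_limit {0..T} (\<lambda>n. c (r n)) g sequentially"
    for c g and r :: "nat \<Rightarrow> nat"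
  proof -
    have limt: "(\<lambda>n. c (r n) t) \<longlonglongrightarrow> g t" if "0 \<le> t" for t
      using tendsto_uniform_limitI[OF lim, of t t] that by auto
    have longr: "\<forall>\<^sub>F n in sequentially. arc_time p (u (r n)) t = t" if "0 \<le> t" for t
      using eventually_subseq[OF r long[OF that]] .
    have g: "g \<in> geodesic_rays" "g 0 = p"
      using gromov_arcs_limit_ray[where u = "\<lambda>n. u (r n)" and c = "\<lambda>n. c (r n)", OF u c limt longr]
      by auto
    have "busemann \<gamma> (g t) p = - t" if t: "0 \<le> t" for t
    proof -
      have 1: "(\<lambda>n. horofunction (u (r n)) (g t) p) \<longlonglongrightarrow> busemann \<gamma> (g t) p"
        using LIMSEQ_subseq_LIMSEQ[OF pt r] by (simp add: o_def)
      \<comment> \<open>The point \<open>g t\<close> may be replaced by \<open>c (r n) t\<close> at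
        the cost of their distance. On the arc itself the value is exactly -t once the arc is long
        enough.\<close>
      have "(\<lambda>n. horofunction (u (r n)) (g t) (c (r n) t)) \<longlonglongrightarrow> 0"
      proof (rule Lim_null_comparison)
        show "(\<lambda>n. dist (c (r n) t) (g t)) \<longlonglongrightarrow> 0"
          using limt[OF t] by (rule tendsto_dist_iff[THEN iffD1])
        show "\<forall>\<^sub>F n in sequentially. norm (horofunction (u (r n)) (g t) (c (r n) t)) \<le> dist (c (r n) t) (g t)"
          using horofunction_abs_le[OF u] by (simp add: dist_commute)
      qed
      then have "(\<lambda>n. horofunction (u (r n)) (g t) p - horofunction (u (r n)) (g t) (c (r n) t))
          \<longlonglongrightarrow> busemann \<gamma> (g t) p - 0"
        by (rule tendsto_diff[OF 1])
      moreover have "\<forall>\<^sub>F n in sequentially.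
          horofunction (u (r n)) (g t) p - horofunction (u (r n)) (g t) (c (r n) t) = - t"
        using longr[OF t]
      proof eventually_elim
        case (elim n)
        then show ?case
          using horofunction_along_arc[OF u c t, of "r n"]
            horofunction_add[OF u, of "r n" "g t" "c (r n) t" p] by simp
      qed
      then have "(\<lambda>n. horofunction (u (r n)) (g t) p - horofunction (u (r n)) (g t) (c (r n) t))
          \<longlonglongrightarrow> - t"
        by (rule tendsto_eventually)
      ultimately show ?thesis
        using LIMSEQ_unique by fastforce
    qed
    then have "asymptotic \<gamma> g"
      using \<gamma>' g by (intro asymptotic_if_busemann_descends) auto
    then show ?thesis
      using gromov_boundary_mem_iff[OF \<xi> \<gamma>'(1)] g by simp
  qed
  then show ?thesis
    unfolding gromov_converges_def Inr by auto
qed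

text \<open>Equal horofunctions make the constant sequence \<open>z\<close> converge to
  \<open>z'\<close>. It remains to see that a constant sequence has no other limit.\<close>

lemma horofunction_inj:
  assumes z: "z \<in> gromov_points" and z': "z' \<in> gromov_points"
    and eq: "\<And>y. horofunction z y p = horofunction z' y p"
  shows "z = z'"
proof -
  have conv: "gromov_converges p (\<lambda>_. z) z'"
    using z z' by (intro uniform_horofunction_limit_imp_gromov_converges) (auto simp: eq intro: uniform_limit_const)
  show ?thesis
  proof (cases z')
    case (Inl x)
    then obtain v where v: "\<forall>\<^sub>F n in sequentially. z = Inl (v n)" "v \<longlonglongrightarrow> x"
      using conv by (auto simp: gromov_converges_def)
    then obtain n where "z = Inl (v n)" using eventually_happens by force
    then obtain w where w: "z = Inl w" by blast
    have "\<forall>\<^sub>F n in sequentially. v n = w"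
      using v(1) by eventually_elim (simp add: w)
    then have "v \<longlonglongrightarrow> w" by (rule tendsto_eventually)
    then show ?thesis using LIMSEQ_unique[OF v(2)] w Inl by simp
  next
    case (Inr \<xi>)
    then have \<xi>: "\<xi> \<in> gromov_boundary" using z' by simp
    obtain c where c: "gromov_arc p z c" using gromov_arc_exists[OF z] by blast
    have "strict_mono (id :: nat \<Rightarrow> nat)" by (simp add: strict_mono_def)
    then have c\<xi>: "c \<in> \<xi>"
      using conv c unfolding gromov_converges_def Inr
      by (auto dest!: spec[of _ "\<lambda>_. c"] spec[of _ "id :: nat \<Rightarrow> nat"] spec[of _ c] intro: uniform_limit_const)
    then have ray: "c \<in> geodesic_rays" by (rule gromov_boundary_rays[OF \<xi>])
    show ?thesis
    proof (cases z)
      case (Inl w)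
      \<comment> \<open>The arc to an interior point rests at its end, which no geodesic ray
        does.\<close>
      have "c (dist p w) = c (dist p w + 1)"
        using c by (simp add: Inl gromov_arc_def)
      then show ?thesis
        using geodesic_rays_dist[OF ray, of "dist p w" "dist p w + 1"] by simp
    next
      case (Inr \<eta>)
      then have "\<eta> \<in> gromov_boundary" "c \<in> \<eta>" using z c by (auto simp: gromov_arc_def)
      then show ?thesis
        using gromov_boundary_mem_iff[of \<eta> c] gromov_boundary_mem_iff[OF \<xi> c\<xi>] Inr \<open>z' = Inr \<xi>\<close>
        by auto
    qed
  qed
qed

text \<open>Either the arcs from \<open>p\<close> become arbitrarily long along the chosen
  subsequence and converge to a ray, whose Busemann function is the limit, or infinitely many end
  points stay in one compact ball and accumulate at an interior point.\<close>

lemma horofunction_limit_of_interior: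
  assumes lim: "\<And>y. (\<lambda>n. horofunction (Inl (v n)) y p) \<longlonglongrightarrow> f y"
  shows "\<exists>z\<in>gromov_points. f = (\<lambda>y. horofunction z y p)"
proof -
  have "\<forall>n. \<exists>c. gromov_arc p (Inl (v n)) c"
    using gromov_arc_interior_exists by blast
  then obtain c where c: "\<And>n. gromov_arc p (Inl (v n)) (c n)" by metis
  obtain r :: "nat \<Rightarrow> nat" and g where r: "strict_mono r"
    and limc: "\<And>t. 0 \<le> t \<Longrightarrow> (\<lambda>n. c (r n) t) \<longlonglongrightarrow> g t"
    by (rule gromov_arcs_subsequence[where c = c, OF Inl_in_gromov_points c]) (rule that)
  have limr: "(\<lambda>n. horofunction (Inl (v (r n))) y p) \<longlonglongrightarrow> f y" for y
    using LIMSEQ_subseq_LIMSEQ[OF lim r] by (simp add: o_def)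
  show ?thesis
  proof (cases "\<forall>t\<ge>0. \<forall>\<^sub>F n in sequentially. arc_time p (Inl (v (r n))) t = t")
    case True
    have g: "g \<in> geodesic_rays"
      using gromov_arcs_limit_ray(1)[where u = "\<lambda>n. Inl (v (r n))" and c = "\<lambda>n. c (r n)",
          OF Inl_in_gromov_points c limc] True by simp
    have "(\<lambda>n. horofunction (Inl (v (r n))) y p) \<longlonglongrightarrow> busemann g y p" for y
      using horofunction_tendsto_busemann[where u = "\<lambda>n. Inl (v (r n))" and c = "\<lambda>n. c (r n)",
          OF Inl_in_gromov_points c limc g] by simp
    then have "f y = busemann g y p" for y
      using LIMSEQ_unique[OF limr] by simp
    then show ?thesis
      using horofunction_boundary[OF asymptotic_class_in_boundary[OF g]]
        asymptotic_class_in_boundary(1)[OF g]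
      by (intro bexI[of _ "Inr (asymptotic_rel `` {g})"]) auto
  next
    case False
    then obtain t where t: "0 \<le> t" "\<not> (\<forall>\<^sub>F n in sequentially. arc_time p (Inl (v (r n))) t = t)"
      by blast
    then obtain s :: "nat \<Rightarrow> nat" where s: "strict_mono s"
      and short: "\<And>n. arc_time p (Inl (v (r (s n)))) t \<noteq> t"
      using not_eventually_sequentiallyD[OF t(2)] by blast
    have "\<forall>n. v (r (s n)) \<in> cball p t"
    proof
      fix n
      show "v (r (s n)) \<in> cball p t"
        using short[of n] by (simp add: arc_time_def min_def split: if_splits)
    qed
    moreover have "seq_compact (cball p t)"
      using proper by (simp add: proper_space_def compact_imp_seq_compact)
    ultimately obtain x q where q: "strict_mono (q :: nat \<Rightarrow> nat)" and x: "((\<lambda>n. v (r (s n))) \<circ> q) \<longlonglongrightarrow> x"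
      by (metis seq_compactE)
    have "f y = horofunction (Inl x) y p" for y
    proof (rule LIMSEQ_unique)
      show "(\<lambda>n. horofunction (Inl (v (r (s (q n))))) y p) \<longlonglongrightarrow> f y"
        using LIMSEQ_subseq_LIMSEQ[OF limr strict_mono_o[OF s q]] by (simp add: o_def)
      show "(\<lambda>n. horofunction (Inl (v (r (s (q n))))) y p) \<longlonglongrightarrow> horofunction (Inl x) y p"
        using x unfolding horofunction_def o_def by (auto intro!: tendsto_intros)
    qed
    then show ?thesis by (intro bexI[of _ "Inl x"]) auto
  qed
qed

end

section \<open>Normalised horofunctions\<close>

lemma tendsto_coordinatewiseI:
  fixes f :: "'b \<Rightarrow> 'c \<Rightarrow> 'd::topological_space"
  assumes "\<And>x. ((\<lambda>n. f n x) \<longlongrightarrow> g x) F"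
  shows "(f \<longlongrightarrow> g) F"
proof -
  have "limitin (product_topology (\<lambda>_. euclidean) UNIV) f g F"
    using assms by (simp add: limitin_componentwise)
  then show ?thesis
    by (simp add: euclidean_product_topology)
qed

text \<open>Vanishing at \<open>p\<close> selects one representative modulo constants. The topology
  used on this set is that of the function type, namely pointwise convergence.\<close>

definition lipschitz_functions :: "'a::metric_space \<Rightarrow> ('a \<Rightarrow> real) set" where
  "lipschitz_functions p = {f. f p = 0 \<and> (\<forall>x y. \<bar>f x - f y\<bar> \<le> dist x y)}"

text \<open>Tychonoff: the conditions are closed for pointwise convergence and confine the value at
  \<open>x\<close> to [-d(x, p), d(x, p)].\<close>

lemma compact_lipschitz_functions: "compact (lipschitz_functions p)"
proof -
  define S where "S x = {- dist x p..dist x p}" for x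
  have "compactin (product_topology (\<lambda>_. euclidean) UNIV) (PiE UNIV S)"
    by (auto simp: compactin_PiE S_def)
  then have compact: "compact (PiE UNIV S)"
    by (simp add: euclidean_product_topology)
  have coord: "continuous_on UNIV (\<lambda>f :: 'a \<Rightarrow> real. f x)" for x
    by simp
  have "closed {f :: 'a \<Rightarrow> real. f p = 0}"
    by (intro closed_Collect_eq coord continuous_on_const)
  moreover have "closed {f :: 'a \<Rightarrow> real. \<bar>f x - f y\<bar> \<le> dist x y}" for x y
    by (intro closed_Collect_le continuous_on_rabs continuous_on_diff coord continuous_on_const)
  ultimately have closed: "closed ({f :: 'a \<Rightarrow> real. f p = 0} \<inter> (\<Inter>x y. {f. \<bar>f x - f y\<bar> \<le> dist x y}))"
    by (intro closed_Int closed_INT ballI) auto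
  have "lipschitz_functions p \<subseteq> PiE UNIV S"
  proof
    fix f assume f: "f \<in> lipschitz_functions p"
    have "f x \<in> S x" for x
    proof -
      have "\<bar>f x - f p\<bar> \<le> dist x p" "f p = 0"
        using f unfolding lipschitz_functions_def by blast+
      then show ?thesis by (auto simp: S_def)
    qed
    then show "f \<in> PiE UNIV S" by auto
  qed
  then have "lipschitz_functions p = PiE UNIV S \<inter>
      ({f. f p = 0} \<inter> (\<Inter>x y. {f. \<bar>f x - f y\<bar> \<le> dist x y}))"
    by (auto simp: lipschitz_functions_def)
  then show ?thesis
    using compact_Int_closed[OF compact closed] by simp
qed

lemma closed_lipschitz_functions: "closed (lipschitz_functions p)"
proof -
  have "Hausdorff_space (euclidean :: ('a \<Rightarrow> real) topology)"
    by (simp add: Hausdorff_space_product_topology flip: euclidean_product_topology)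
  then show ?thesis
    using compactin_imp_closedin compact_lipschitz_functions by fastforce
qed

lemma continuous_lipschitz_functions: "f \<in> lipschitz_functions p \<Longrightarrow> f \<in> continuous_functions"
proof -
  assume f: "f \<in> lipschitz_functions p"
  have "\<exists>d>0. \<forall>y. dist y x < d \<longrightarrow> dist (f y) (f x) < e" if "0 < e" for x e
    using f that by (intro exI[of _ e]) (auto simp: lipschitz_functions_def dist_real_def intro: le_less_trans)
  then show ?thesis
    by (auto simp: continuous_functions_def continuous_on_iff)
qed

text \<open>On Lipschitz functions, pointwise convergence is locally uniform.\<close>

lemma lipschitz_functions_neighbourhood:
  assumes f: "f \<in> lipschitz_functions p" and K: "compact K" and e: "0 < e"
  obtains W where "open W" "f \<in> W"
    "\<And>g x. g \<in> W \<inter> lipschitz_functions p \<Longrightarrow> x \<in> K \<Longrightarrow> \<bar>g x - f x\<bar> < e"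
proof -
  obtain F where F: "finite F" "F \<subseteq> K" "K \<subseteq> (\<Union>x\<in>F. ball x (e / 3))"
    by (rule compact_finite_net[OF K, of "e / 3"]) (use e in auto)
  define W where "W = (\<Inter>x\<in>F. {g. \<bar>g x - f x\<bar> < e / 3})"
  have "open {g :: 'a \<Rightarrow> real. \<bar>g x - f x\<bar> < e / 3}" for x
    by (intro open_Collect_less continuous_on_rabs continuous_on_diff continuous_on_const
        continuous_on_product_coordinates)
  then have "open W"
    unfolding W_def using F(1) by (intro open_INT) auto
  moreover have "f \<in> W" using e by (simp add: W_def)
  moreover have "\<bar>g x - f x\<bar> < e" if g: "g \<in> W \<inter> lipschitz_functions p" and x: "x \<in> K" for g x
  proof -
    obtain y where y: "y \<in> F" "dist y x < e / 3" using F(3) x by auto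
    have "\<bar>g x - g y\<bar> \<le> dist x y" "\<bar>f x - f y\<bar> \<le> dist x y" "\<bar>g y - f y\<bar> < e / 3"
      using f g y(1) by (auto simp: lipschitz_functions_def W_def)
    then show ?thesis using y(2) dist_commute[of x y] by linarith
  qed
  ultimately show thesis using that by blast
qed

definition horo_functions :: "'a::metric_space \<Rightarrow> ('a \<Rightarrow> real) set" where
  "horo_functions p = closure (range (\<lambda>x y. dist y x - dist p x))"

lemma horo_functions_subset: "horo_functions p \<subseteq> lipschitz_functions p"
  unfolding horo_functions_def
proof (rule closure_minimal[OF _ closed_lipschitz_functions])
  show "range (\<lambda>x y. dist y x - dist p x) \<subseteq> lipschitz_functions p"
  proof clarify
    fix x :: 'a
    have "\<bar>dist y x - dist w x\<bar> \<le> dist y w" for y w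
      using dist_triangle[of y x w] dist_triangle[of w x y] by (simp add: dist_commute abs_le_iff)
    then show "(\<lambda>y. dist y x - dist p x) \<in> lipschitz_functions p"
      by (simp add: lipschitz_functions_def)
  qed
qed

lemma compact_horo_functions: "compact (horo_functions p)"
proof -
  have "lipschitz_functions p \<inter> horo_functions p = horo_functions p"
    using horo_functions_subset by blast
  then show ?thesis
    using compact_Int_closed[OF compact_lipschitz_functions[of p], of "horo_functions p"]
    by (simp add: horo_functions_def)
qed

section \<open>The quotient by constants in terms of normalised functions\<close>

definition normalise :: "'a \<Rightarrow> ('a \<Rightarrow> real) set \<Rightarrow> 'a \<Rightarrow> real" where
  "normalise p C x = (SOME h. h \<in> C) x - (SOME h. h \<in> C) p"

text \<open>Representatives of a class differ by a constant, which cancels in the difference, so the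
  choice made by \<open>SOME\<close> has no effect.\<close>

lemma normalise_const_class: "normalise p (const_class h) = (\<lambda>x. h x - h p)"
proof -
  have "h \<in> const_class h" by (auto simp: const_class_def intro: exI[of _ 0])
  then have "(SOME k. k \<in> const_class h) \<in> const_class h" by (rule someI[where P = "\<lambda>k. k \<in> const_class h"])
  then obtain c where "\<And>x. (SOME k. k \<in> const_class h) x = h x + c"
    unfolding const_class_def by auto
  then show ?thesis by (auto simp: normalise_def)
qed

lemma const_class_eqI:
  assumes "\<And>x. f x = g x + c" shows "const_class f = const_class g"
proof -
  have "(\<exists>d. \<forall>x. h x = f x + d) \<longleftrightarrow> (\<exists>d. \<forall>x. h x = g x + d)" for h
  proof
    assume "\<exists>d. \<forall>x. h x = f x + d"
    then obtain d where "\<forall>x. h x = f x + d" by blast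
    then show "\<exists>d. \<forall>x. h x = g x + d" using assms by (intro exI[of _ "c + d"]) simp
  next
    assume "\<exists>d. \<forall>x. h x = g x + d"
    then obtain d where "\<forall>x. h x = g x + d" by blast
    then show "\<exists>d. \<forall>x. h x = f x + d" using assms by (intro exI[of _ "d - c"]) simp
  qed
  then show ?thesis by (simp add: const_class_def)
qed

lemma continuous_map_evaluation:
  "continuous_map compact_conv_topology euclideanreal (\<lambda>h. h x)"
  unfolding continuous_map_def
proof (intro conjI allI impI)
  fix U :: "real set" assume "openin euclidean U"
  then have U: "open U" by simp
  show "openin compact_conv_topology {h \<in> topspace compact_conv_topology. h x \<in> U}"
    unfolding openin_compact_conv_topology compact_conv_open_def topspace_compact_conv_topology
  proof (intro conjI ballI)
    fix f assume "f \<in> {h \<in> continuous_functions. h x \<in> U}"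
    then obtain e where "0 < e" "\<And>r. \<bar>r - f x\<bar> < e \<Longrightarrow> r \<in> U"
      using U unfolding open_dist dist_real_def by blast
    then show "\<exists>K e. compact K \<and> 0 < e \<and>
        {g \<in> continuous_functions. \<forall>x\<in>K. \<bar>g x - f x\<bar> < e} \<subseteq> {h \<in> continuous_functions. h x \<in> U}"
      by (intro exI[of _ "{x}"] exI[of _ e]) auto
  qed auto
qed auto

text \<open>By the universal property of the quotient it is enough that h(x) - h(p) depends
  continuously on h for each x.\<close>

lemma continuous_map_normalise: "continuous_map quotient_by_constants euclidean (normalise p)"
proof (rule continuous_compose_quotient_map[OF quotient_map_const_class])
  have "continuous_map compact_conv_topology (product_topology (\<lambda>_. euclidean) UNIV)
      (\<lambda>h x. h x - h p)"
    by (simp add: continuous_map_componentwise_UNIV continuous_map_diff continuous_map_evaluation)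
  then show "continuous_map compact_conv_topology euclidean (normalise p \<circ> const_class)"
    by (simp add: o_def normalise_const_class euclidean_product_topology)
qed

text \<open>Normalisation is a continuous injection into a Hausdorff product. Any base point serves
  for this, and \<open>undefined\<close> provides one.\<close>

lemma Hausdorff_quotient_by_constants:
  "Hausdorff_space (quotient_by_constants :: ('a::metric_space \<Rightarrow> real) set topology)"
proof (rule Hausdorff_space_injective_preimage[OF _ continuous_map_normalise[of undefined]])
  show "Hausdorff_space (euclidean :: ('a \<Rightarrow> real) topology)"
    by (simp add: Hausdorff_space_product_topology flip: euclidean_product_topology)
  show "inj_on (normalise undefined)
      (topspace (quotient_by_constants :: ('a \<Rightarrow> real) set topology))"
    unfolding topspace_quotient_by_constants
  proof (rule inj_onI, clarify)
    fix f g :: "'a \<Rightarrow> real"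
    assume "normalise undefined (const_class f) = normalise undefined (const_class g)"
    then have "f x = g x + (f undefined - g undefined)" for x
      unfolding normalise_const_class by (auto dest: fun_cong[of _ _ x])
    then show "const_class f = const_class g" by (rule const_class_eqI)
  qed
qed

text \<open>Here the pointwise topology is matched with uniform convergence on compact sets: for
  Lipschitz functions a pointwise neighbourhood controls the values on all of
  \<open>K\<close>.\<close>

lemma continuous_map_const_class:
  "continuous_map (top_of_set (lipschitz_functions p)) quotient_by_constants const_class"
  unfolding continuous_map_def
proof (intro conjI allI impI)
  show "const_class \<in> topspace (top_of_set (lipschitz_functions p)) \<rightarrow> topspace quotient_by_constants"
    using continuous_lipschitz_functions by (auto simp: topspace_quotient_by_constants)
next
  fix V :: "('a \<Rightarrow> real) set set" assume "openin quotient_by_constants V"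
  then have V: "compact_conv_open {f \<in> continuous_functions. const_class f \<in> V}"
    by (simp add: openin_quotient_by_constants quotient_open_def openin_compact_conv_topology)
  show "openin (top_of_set (lipschitz_functions p))
      {f \<in> topspace (top_of_set (lipschitz_functions p)). const_class f \<in> V}"
  proof (subst openin_subopen, intro ballI)
    fix f assume "f \<in> {f \<in> topspace (top_of_set (lipschitz_functions p)). const_class f \<in> V}"
    then have f: "f \<in> lipschitz_functions p" "f \<in> {f \<in> continuous_functions. const_class f \<in> V}"
      using continuous_lipschitz_functions by auto
    obtain K e where K: "compact K" "0 < e"
      "{g \<in> continuous_functions. \<forall>x\<in>K. \<bar>g x - f x\<bar> < e} \<subseteq> {f \<in> continuous_functions. const_class f \<in> V}"
      using V f(2) unfolding compact_conv_open_def by blast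
    obtain W where W: "open W" "f \<in> W"
      "\<And>g x. g \<in> W \<inter> lipschitz_functions p \<Longrightarrow> x \<in> K \<Longrightarrow> \<bar>g x - f x\<bar> < e"
      by (rule lipschitz_functions_neighbourhood[OF f(1) K(1,2)]) (rule that)
    have "const_class g \<in> V" if g: "g \<in> lipschitz_functions p \<inter> W" for g
    proof -
      have "g \<in> {g \<in> continuous_functions. \<forall>x\<in>K. \<bar>g x - f x\<bar> < e}"
        using W(3)[of g] g continuous_lipschitz_functions by auto
      then show ?thesis using K(3) by blast
    qed
    then show "\<exists>T. openin (top_of_set (lipschitz_functions p)) T \<and> f \<in> T \<and>
        T \<subseteq> {f \<in> topspace (top_of_set (lipschitz_functions p)). const_class f \<in> V}"
      using W(1,2) f(1)
      by (intro exI[of _ "lipschitz_functions p \<inter> W"]) (auto simp: openin_open)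
  qed
qed

lemma horo_embedding_eq: "horo_embedding x = const_class (\<lambda>y. dist y x - dist p x)"
  unfolding horo_embedding_def by (rule const_class_eqI[of _ _ "dist p x"]) simp

text \<open>The image of the compact model is compact, hence closed in the Hausdorff quotient, and
  it contains the embedded space, hence its closure. The other inclusion is continuity of
  \<open>const_class\<close>.\<close>

lemma const_class_horo_functions: "const_class ` horo_functions p = horo_points"
proof
  let ?L = "top_of_set (lipschitz_functions p)"
  have img: "const_class ` range (\<lambda>x y. dist y x - dist p x) = range horo_embedding"
    by (auto simp: horo_embedding_eq[of _ p])
  have "compactin ?L (horo_functions p)"
    by (simp add: compactin_subtopology horo_functions_subset compact_horo_functions)
  then have "compactin quotient_by_constants (const_class ` horo_functions p)"
    using continuous_map_const_class by (rule image_compactin)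
  then have "closedin quotient_by_constants (const_class ` horo_functions p)"
    using Hausdorff_quotient_by_constants by (rule compactin_imp_closedin[rotated])
  moreover have "range horo_embedding \<subseteq> const_class ` horo_functions p"
    unfolding img[symmetric] horo_functions_def by (intro image_mono closure_subset)
  ultimately show "horo_points \<subseteq> const_class ` horo_functions p"
    unfolding horo_points_def by (rule closure_of_minimal[rotated])
  have "?L closure_of range (\<lambda>x y. dist y x - dist p x) = horo_functions p"
  proof -
    have "range (\<lambda>x y. dist y x - dist p x) \<subseteq> lipschitz_functions p"
      using horo_functions_subset closure_subset unfolding horo_functions_def by blast
    then show ?thesis
      using horo_functions_subset[of p]
      by (simp add: closure_of_subtopology Int_absorb1 horo_functions_def)
  qed
  then show "const_class ` horo_functions p \<subseteq> horo_points"
    using continuous_map_image_closure_subset[OF continuous_map_const_class[of p],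
        of "range (\<lambda>x y. dist y x - dist p x)"]
    by (simp add: img horo_points_def)
qed

lemma horo_points_subset: "horo_points \<subseteq> topspace quotient_by_constants"
  unfolding horo_points_def by (rule closure_of_subset_topspace)

lemma homeomorphic_map_const_class:
  "homeomorphic_map (top_of_set (horo_functions p)) horo_compactification const_class"
proof -
  have inv: "normalise p (const_class f) = f" if "f \<in> horo_functions p" for f
    using that horo_functions_subset[of p] by (auto simp: normalise_const_class lipschitz_functions_def)
  have "homeomorphic_maps (top_of_set (horo_functions p)) horo_compactification const_class (normalise p)"
    unfolding homeomorphic_maps_def
  proof (intro conjI)
    show "continuous_map (top_of_set (horo_functions p)) horo_compactification const_class"
      using continuous_map_from_subtopology_mono[OF continuous_map_const_class horo_functions_subset]
      by (auto simp: horo_compactification_def continuous_map_in_subtopology const_class_horo_functions[of p, symmetric])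
    show "continuous_map horo_compactification (top_of_set (horo_functions p)) (normalise p)"
      using continuous_map_from_subtopology[OF continuous_map_normalise] inv horo_points_subset
      by (auto simp: horo_compactification_def continuous_map_in_subtopology Int_absorb1
          const_class_horo_functions[of p, symmetric])
    show "\<forall>f\<in>topspace (top_of_set (horo_functions p)). normalise p (const_class f) = f"
      using inv by simp
    show "\<forall>C\<in>topspace horo_compactification. const_class (normalise p C) = C"
      using inv by (auto simp: horo_compactification_def const_class_horo_functions[of p, symmetric])
  qed
  then show ?thesis by (auto simp: homeomorphic_map_maps)
qed


section \<open>The homeomorphism\<close>

text \<open>Sequences test openness in the metric space, which gives continuity. A sequence
  converging to an interior point is eventually interior by definition, so images of open sets are
  open.\<close>

lemma embedding_map_Inl_gromov: "embedding_map euclidean (gromov_compactification p) Inl"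
proof (rule injective_open_imp_embedding_map)
  show "continuous_map euclidean (gromov_compactification p) Inl"
    unfolding continuous_map_def
  proof (intro conjI allI impI)
    fix U :: "'a gromov_point set" assume "openin (gromov_compactification p) U"
    then have U: "gromov_open p U" by (simp add: openin_gromov_compactification)
    have "open {x. Inl x \<in> U}"
    proof (subst open_subopen, intro ballI)
      fix x assume x: "x \<in> {x. Inl x \<in> U}"
      have "\<forall>\<^sub>F y in nhds x. Inl y \<in> U"
      proof (rule eventually_nhds_iff_sequentially[THEN iffD2], intro allI impI)
        fix v assume "v \<longlonglongrightarrow> x"
        then have "gromov_converges p (\<lambda>n. Inl (v n)) (Inl x)"
          by (auto simp: gromov_converges_def intro!: exI[of _ v])
        moreover have "range (\<lambda>n. Inl (v n)) \<subseteq> gromov_points" by auto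
        ultimately show "\<forall>\<^sub>F n in sequentially. Inl (v n) \<in> U"
          using U x unfolding gromov_open_def by blast
      qed
      then show "\<exists>T. open T \<and> x \<in> T \<and> T \<subseteq> {x. Inl x \<in> U}"
        by (auto simp: eventually_nhds)
    qed
    then show "openin euclidean {x \<in> topspace euclidean. Inl x \<in> U}" by simp
  qed (auto simp: topspace_gromov_compactification)
  show "open_map euclidean (gromov_compactification p) Inl"
    unfolding open_map_def
  proof (intro allI impI)
    fix V :: "'a set" assume "openin euclidean V"
    then have V: "open V" by simp
    show "openin (gromov_compactification p) (Inl ` V)"
      unfolding openin_gromov_compactification gromov_open_def
    proof (intro conjI ballI allI impI)
      fix z u assume "z \<in> Inl ` V" and u: "range u \<subseteq> gromov_points \<and> gromov_converges p u z"
      then obtain x v where x: "x \<in> V" and v: "\<forall>\<^sub>F n in sequentially. u n = Inl (v n)" "v \<longlonglongrightarrow> x"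
        by (auto simp: gromov_converges_def)
      have "\<forall>\<^sub>F n in sequentially. v n \<in> V"
        using v(2) V x by (rule topological_tendstoD)
      with v(1) show "\<forall>\<^sub>F n in sequentially. u n \<in> Inl ` V"
        by eventually_elim simp
    qed auto
  qed
qed (simp add: inj_on_def)

context approaching_geodesics_space
begin

abbreviation normalised_horofunction :: "'a gromov_point \<Rightarrow> 'a \<Rightarrow> real" where
  "normalised_horofunction z \<equiv> (\<lambda>y. horofunction z y p)"

lemma normalised_horofunction_lipschitz:
  assumes "z \<in> gromov_points"
  shows "normalised_horofunction z \<in> lipschitz_functions p"
proof -
  have "\<bar>horofunction z x p - horofunction z y p\<bar> \<le> dist x y" for x y
    using horofunction_abs_le[OF assms, of x y] horofunction_add[OF assms, of x y p] by simp
  then show ?thesis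
    using horofunction_refl[OF assms] by (simp add: lipschitz_functions_def)
qed

text \<open>A Busemann function is the pointwise limit of the horofunctions of the points
  \<open>\<gamma> n\<close>. Conversely, a member of the closure is a limit of interior
  horofunctions along a sequence, to which \<open>horofunction_limit_of_interior\<close>
  applies.\<close>

lemma normalised_horofunction_surj: "normalised_horofunction ` gromov_points = horo_functions p"
proof
  let ?R = "range (\<lambda>x y. dist y x - dist p x)"
  have inl: "normalised_horofunction (Inl x) \<in> ?R" for x
    by (auto simp: horofunction_def)
  show "normalised_horofunction ` gromov_points \<subseteq> horo_functions p"
  proof clarify
    fix z :: "'a gromov_point" assume z: "z \<in> gromov_points"
    show "normalised_horofunction z \<in> horo_functions p"
    proof (cases z)
      case (Inl x)
      then show ?thesis
        using inl closure_subset unfolding horo_functions_def by blast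
    next
      case (Inr \<xi>)
      then have \<xi>: "\<xi> \<in> gromov_boundary" using z by simp
      then obtain \<gamma> where \<gamma>: "\<gamma> \<in> \<xi>" using gromov_boundary_nonempty by blast
      have "(\<lambda>n. dist y (\<gamma> (real n)) - dist (\<gamma> (real n)) p) \<longlonglongrightarrow> busemann \<gamma> y p" for y
        using filterlim_compose[OF busemann_tendsto[OF gromov_boundary_rays[OF \<xi> \<gamma>]]
            filterlim_real_sequentially] .
      then have "(\<lambda>n. normalised_horofunction (Inl (\<gamma> (real n)))) \<longlonglongrightarrow> normalised_horofunction z"
        by (intro tendsto_coordinatewiseI)
          (simp add: Inr horofunction_boundary[OF \<xi> \<gamma>], simp add: horofunction_def dist_commute)
      moreover have "\<forall>\<^sub>F n in sequentially. normalised_horofunction (Inl (\<gamma> (real n))) \<in> closure ?R"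
        using inl closure_subset by (intro always_eventually) blast
      ultimately show ?thesis
        unfolding horo_functions_def
        by (intro Lim_in_closed_set[OF closed_closure _ sequentially_bot]) auto
    qed
  qed
  show "horo_functions p \<subseteq> normalised_horofunction ` gromov_points"
  proof
    fix f assume f: "f \<in> horo_functions p"
    then have fL: "f \<in> lipschitz_functions p" using horo_functions_subset by blast
    \<comment> \<open>Membership in the closure yields no sequence by itself. Approximation on
      growing balls with shrinking error produces one.\<close>
    have "\<exists>v. \<forall>x\<in>cball p (real n). \<bar>horofunction (Inl v) x p - f x\<bar> < 1 / real (Suc n)" for n
    proof -
      have K: "compact (cball p (real n))" "0 < 1 / real (Suc n)"
        using proper by (simp_all add: proper_space_def)
      obtain W where W: "open W" "f \<in> W"
        "\<And>g x. g \<in> W \<inter> lipschitz_functions p \<Longrightarrow> x \<in> cball p (real n) \<Longrightarrow> \<bar>g x - f x\<bar> < 1 / real (Suc n)"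
        by (rule lipschitz_functions_neighbourhood[OF fL K]) (rule that)
      obtain v where "(\<lambda>y. dist y v - dist p v) \<in> W"
        using f W(1,2) open_Int_closure_eq_empty[of W ?R] unfolding horo_functions_def by blast
      then have "normalised_horofunction (Inl v) \<in> W \<inter> lipschitz_functions p"
        using normalised_horofunction_lipschitz[of "Inl v"] by (simp add: horofunction_def)
      then show ?thesis using W(3) by blast
    qed
    then obtain v where v:
      "\<And>n x. x \<in> cball p (real n) \<Longrightarrow> \<bar>horofunction (Inl (v n)) x p - f x\<bar> < 1 / real (Suc n)"
      by metis
    have "(\<lambda>n. horofunction (Inl (v n)) y p) \<longlonglongrightarrow> f y" for y
    proof (rule LIM_zero_cancel, rule Lim_null_comparison)
      show "(\<lambda>n. 1 / real (Suc n)) \<longlonglongrightarrow> 0"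
        using LIMSEQ_inverse_real_of_nat by (simp add: inverse_eq_divide)
      obtain N where "dist p y \<le> real N" using real_arch_simple by blast
      then have "norm (horofunction (Inl (v n)) y p - f y) \<le> 1 / real (Suc n)" if "N \<le> n" for n
        using v[of y n] that by simp
      then show "\<forall>\<^sub>F n in sequentially. norm (horofunction (Inl (v n)) y p - f y) \<le> 1 / real (Suc n)"
        using eventually_sequentially by blast
    qed
    then show "f \<in> normalised_horofunction ` gromov_points"
      using horofunction_limit_of_interior[of v f] by blast
  qed
qed

text \<open>Sequential openness becomes a genuine neighbourhood: if every \<open>n\<close> failed,
  the counterexamples would form a sequence outside \<open>U\<close> whose horofunctions converge
  locally uniformly, so that it would Gromov-converge to \<open>z\<close>.\<close>

lemma normalised_horofunction_open:
  assumes U: "gromov_open p U" and z: "z \<in> U"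
  shows "\<exists>n. \<forall>w\<in>gromov_points.
    (\<forall>y\<in>cball p (real n). \<bar>horofunction w y p - horofunction z y p\<bar> < 1 / real (Suc n)) \<longrightarrow> w \<in> U"
proof (rule ccontr)
  assume "\<not> ?thesis"
  then have "\<forall>n. \<exists>w. w \<in> gromov_points \<and> w \<notin> U \<and>
    (\<forall>y\<in>cball p (real n). \<bar>horofunction w y p - horofunction z y p\<bar> < 1 / real (Suc n))"
    by blast
  then obtain u where u: "\<And>n. u n \<in> gromov_points" "\<And>n. u n \<notin> U"
    "\<And>n y. y \<in> cball p (real n) \<Longrightarrow> \<bar>horofunction (u n) y p - horofunction z y p\<bar> < 1 / real (Suc n)"
    by metis
  have zp: "z \<in> gromov_points" using U z by (auto simp: gromov_open_def)
  have "gromov_converges p u z"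
  proof (rule uniform_horofunction_limit_imp_gromov_converges[OF u(1) zp])
    fix K :: "'a set" assume "compact K"
    then have "bounded K" by (rule compact_imp_bounded)
    then obtain R where "\<forall>y\<in>K. dist p y \<le> R" using bounded_any_center by blast
    then have R: "K \<subseteq> cball p R" by auto
    show "uniform_limit K (\<lambda>n y. horofunction (u n) y p) (\<lambda>y. horofunction z y p) sequentially"
    proof (rule uniform_limitI)
      fix e :: real assume "0 < e"
      then obtain N where N: "1 / real (Suc N) < e"
        using reals_Archimedean[of e] by (auto simp: inverse_eq_divide)
      obtain M where M: "R \<le> real M" using real_arch_simple by blast
      show "\<forall>\<^sub>F n in sequentially. \<forall>y\<in>K. dist (horofunction (u n) y p) (horofunction z y p) < e"
        using eventually_ge_at_top[of "max M N"]
      proof eventually_elim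
        case (elim n)
        show ?case
        proof
          fix y assume "y \<in> K"
          then have "y \<in> cball p (real n)" using R M elim by fastforce
          then have "\<bar>horofunction (u n) y p - horofunction z y p\<bar> < 1 / real (Suc n)" by (rule u(3))
          also have "\<dots> \<le> 1 / real (Suc N)" using elim by (simp add: frac_le)
          finally show "dist (horofunction (u n) y p) (horofunction z y p) < e"
            using N by (simp add: dist_real_def)
        qed
      qed
    qed
  qed
  moreover have "range u \<subseteq> gromov_points" using u(1) by auto
  ultimately have "\<forall>\<^sub>F n in sequentially. u n \<in> U"
    using U z unfolding gromov_open_def by blast
  then show False using u(2) by simp
qed

text \<open>Continuity is the passage from Gromov convergence to pointwise convergence. Openness
  combines \<open>normalised_horofunction_open\<close> with the fact that pointwise neighbourhoods
  of Lipschitz functions control whole balls.\<close>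

lemma homeomorphic_map_normalised_horofunction:
  "homeomorphic_map (gromov_compactification p) (top_of_set (horo_functions p)) normalised_horofunction"
proof (rule bijective_open_imp_homeomorphic_map)
  show surj: "normalised_horofunction ` topspace (gromov_compactification p) =
      topspace (top_of_set (horo_functions p))"
    by (simp add: topspace_gromov_compactification normalised_horofunction_surj)
  show "inj_on normalised_horofunction (topspace (gromov_compactification p))"
    unfolding topspace_gromov_compactification
    by (rule inj_onI) (auto intro: horofunction_inj dest: fun_cong)
  show "continuous_map (gromov_compactification p) (top_of_set (horo_functions p)) normalised_horofunction"
    unfolding continuous_map_def
  proof (intro conjI allI impI)
    show "normalised_horofunction \<in>
        topspace (gromov_compactification p) \<rightarrow> topspace (top_of_set (horo_functions p))"
      using surj by blast
    fix V assume "openin (top_of_set (horo_functions p)) V"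
    then obtain W where W: "open W" "V = horo_functions p \<inter> W" by (auto simp: openin_open)
    show "openin (gromov_compactification p)
        {z \<in> topspace (gromov_compactification p). normalised_horofunction z \<in> V}"
      unfolding openin_gromov_compactification gromov_open_def topspace_gromov_compactification
    proof (intro conjI ballI allI impI)
      fix z u assume z: "z \<in> {z \<in> gromov_points. normalised_horofunction z \<in> V}"
        and "range u \<subseteq> gromov_points \<and> gromov_converges p u z"
      then have u: "\<And>n. u n \<in> gromov_points" "gromov_converges p u z" by auto
      have "(\<lambda>n. normalised_horofunction (u n)) \<longlonglongrightarrow> normalised_horofunction z"
        using z u by (intro tendsto_coordinatewiseI gromov_converges_imp_horofunction_tendsto) auto
      then have "\<forall>\<^sub>F n in sequentially. normalised_horofunction (u n) \<in> W"
        using W z by (intro topological_tendstoD) auto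
      then show "\<forall>\<^sub>F n in sequentially. u n \<in> {z \<in> gromov_points. normalised_horofunction z \<in> V}"
        by eventually_elim (use u W normalised_horofunction_surj in auto)
    qed auto
  qed
  show "open_map (gromov_compactification p) (top_of_set (horo_functions p)) normalised_horofunction"
    unfolding open_map_def
  proof (intro allI impI)
    fix U assume "openin (gromov_compactification p) U"
    then have U: "gromov_open p U" "U \<subseteq> gromov_points"
      by (auto simp: openin_gromov_compactification gromov_open_def)
    show "openin (top_of_set (horo_functions p)) (normalised_horofunction ` U)"
    proof (subst openin_subopen, intro ballI)
      fix f assume "f \<in> normalised_horofunction ` U"
      then obtain z where z: "z \<in> U" "f = normalised_horofunction z" by blast
      obtain n where n: "\<And>w. w \<in> gromov_points \<Longrightarrow>
        (\<And>y. y \<in> cball p (real n) \<Longrightarrow> \<bar>horofunction w y p - f y\<bar> < 1 / real (Suc n)) \<Longrightarrow> w \<in> U"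
        using normalised_horofunction_open[OF U(1) z(1)] z(2) by blast
      have fL: "f \<in> lipschitz_functions p"
        using z U normalised_horofunction_lipschitz by auto
      have K: "compact (cball p (real n))" "0 < 1 / real (Suc n)"
        using proper by (simp_all add: proper_space_def)
      obtain W where W: "open W" "f \<in> W"
        "\<And>g x. g \<in> W \<inter> lipschitz_functions p \<Longrightarrow> x \<in> cball p (real n) \<Longrightarrow> \<bar>g x - f x\<bar> < 1 / real (Suc n)"
        by (rule lipschitz_functions_neighbourhood[OF fL K]) (rule that)
      have "horo_functions p \<inter> W \<subseteq> normalised_horofunction ` U"
      proof
        fix g assume g: "g \<in> horo_functions p \<inter> W"
        then obtain w where w: "w \<in> gromov_points" "g = normalised_horofunction w"
          using normalised_horofunction_surj by blast
        have "\<bar>horofunction w y p - f y\<bar> < 1 / real (Suc n)" if "y \<in> cball p (real n)" for y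
          using W(3)[of g y] g that horo_functions_subset[of p] w(2) by auto
        then have "w \<in> U" by (rule n[OF w(1)])
        then show "g \<in> normalised_horofunction ` U" using w(2) by blast
      qed
      moreover have "f \<in> horo_functions p"
        using z U normalised_horofunction_surj by blast
      ultimately show "\<exists>T. openin (top_of_set (horo_functions p)) T \<and> f \<in> T \<and>
          T \<subseteq> normalised_horofunction ` U"
        using W(1,2) by (intro exI[of _ "horo_functions p \<inter> W"]) (auto simp: openin_open)
    qed
  qed
qed

lemma busemann_class_asymptotic:
  assumes "\<gamma> \<in> geodesic_rays" "\<sigma> \<in> geodesic_rays" "asymptotic \<gamma> (\<sigma> :: real \<Rightarrow> 'a)"
  shows "busemann_class \<gamma> y = busemann_class \<sigma> y'"
  unfolding busemann_class_def
  using busemann_asymptotic[OF assms] busemann_add[OF assms(2), of _ y' y]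
  by (intro const_class_eqI[of _ _ "busemann \<sigma> y' y"]) simp

lemma gromov_to_horo_Inr:
  assumes "\<xi> \<in> gromov_boundary" "(\<gamma> :: real \<Rightarrow> 'a) \<in> \<xi>"
  shows "gromov_to_horo (Inr \<xi>) = busemann_class \<gamma> y"
proof -
  have "(THE c. \<exists>\<gamma>\<in>\<xi>. \<exists>y. c = busemann_class \<gamma> y) = busemann_class \<gamma> y"
  proof (rule the_equality)
    show "\<exists>\<gamma>'\<in>\<xi>. \<exists>y'. busemann_class \<gamma> y = busemann_class \<gamma>' y'" using assms(2) by blast
    fix c assume "\<exists>\<gamma>\<in>\<xi>. \<exists>y. c = busemann_class \<gamma> y"
    then obtain \<sigma> y' where \<sigma>: "\<sigma> \<in> \<xi>" "c = busemann_class \<sigma> y'" by blast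
    then have "asymptotic \<sigma> \<gamma>" using gromov_boundary_mem_iff[OF assms(1) \<sigma>(1)] assms(2) by simp
    then show "c = busemann_class \<gamma> y"
      using busemann_class_asymptotic[of \<sigma> \<gamma>] gromov_boundary_rays[OF assms(1)] \<sigma> assms(2) by simp
  qed
  then show ?thesis by (simp add: gromov_to_horo_def)
qed

lemma gromov_to_horo_eq:
  assumes "z \<in> gromov_points"
  shows "gromov_to_horo z = const_class (normalised_horofunction z)"
proof (cases z)
  case (Inl x)
  then show ?thesis by (simp add: gromov_to_horo_def horo_embedding_eq[of x p] horofunction_def)
next
  case (Inr \<xi>)
  then have \<xi>: "\<xi> \<in> gromov_boundary" using assms by simp
  then obtain \<gamma> where \<gamma>: "\<gamma> \<in> \<xi>" using gromov_boundary_nonempty by blast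
  show ?thesis
    by (simp add: Inr gromov_to_horo_Inr[OF \<xi> \<gamma>, of p] horofunction_boundary[OF \<xi> \<gamma>] busemann_class_def)
qed

lemma homeomorphic_map_gromov_to_horo:
  "homeomorphic_map (gromov_compactification p) horo_compactification gromov_to_horo"
proof (rule homeomorphic_map_eq)
  show "homeomorphic_map (gromov_compactification p) horo_compactification
      (const_class \<circ> normalised_horofunction)"
    using homeomorphic_map_normalised_horofunction homeomorphic_map_const_class
    by (rule homeomorphic_map_compose)
qed (simp add: topspace_gromov_compactification gromov_to_horo_eq)

lemma gromov_to_horo_comp_Inl: "gromov_to_horo \<circ> Inl = (horo_embedding :: 'a \<Rightarrow> _)"
  by (auto simp: gromov_to_horo_def)

text \<open>The class is the image of a boundary point, and injectivity of the homeomorphism keeps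
  it apart from the images of interior points.\<close>

lemma busemann_class_in_boundary:
  assumes \<gamma>: "\<gamma> \<in> geodesic_rays"
  shows "busemann_class \<gamma> (y::'a) \<in> horo_boundary"
proof -
  define z :: "'a gromov_point" where "z = Inr (asymptotic_rel `` {\<gamma>})"
  have z: "z \<in> gromov_points"
    using asymptotic_class_in_boundary[OF \<gamma>] by (simp add: z_def)
  have eq: "busemann_class \<gamma> y = gromov_to_horo z"
    using gromov_to_horo_Inr[OF asymptotic_class_in_boundary[OF \<gamma>], of y] by (simp add: z_def)
  have "gromov_to_horo z \<in> topspace horo_compactification"
    using homeomorphic_imp_surjective_map[OF homeomorphic_map_gromov_to_horo] z
    by (auto simp: topspace_gromov_compactification)
  then have "gromov_to_horo z \<in> horo_points"
    by (simp add: horo_compactification_def)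
  moreover have "gromov_to_horo z \<noteq> horo_embedding x" for x
  proof
    assume "gromov_to_horo z = horo_embedding x"
    then have "gromov_to_horo z = gromov_to_horo (Inl x)"
      by (simp add: fun_cong[OF gromov_to_horo_comp_Inl, simplified])
    then have "z = Inl x"
      using homeomorphic_imp_injective_map[OF homeomorphic_map_gromov_to_horo] z
      by (auto simp: topspace_gromov_compactification dest: inj_onD)
    then show False by (simp add: z_def)
  qed
  ultimately show ?thesis by (auto simp: horo_boundary_def eq)
qed

text \<open>The properties travel in both directions. Compactness, the Hausdorff property and
  density are known on the horofunction side and pulled back. That the space is embedded is known on
  the Gromov side and pushed forward.\<close>

lemma topologically_equivalent_gromov_horo:
  "topologically_equivalent Inl (gromov_compactification p) horo_embedding
    (horo_compactification :: ('a \<Rightarrow> real) set topology)"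
proof -
  let ?G = "gromov_compactification p" and ?H = "horo_compactification :: ('a \<Rightarrow> real) set topology"
  note hom = homeomorphic_map_gromov_to_horo
  have "compact_space (top_of_set (horo_functions p))"
    by (simp add: compact_space_subtopology compact_horo_functions)
  then have cH: "compact_space ?H"
    using homeomorphic_compact_space[OF
        homeomorphic_map_imp_homeomorphic_space[OF homeomorphic_map_const_class[of p]]] by simp
  have hH: "Hausdorff_space ?H"
    unfolding horo_compactification_def
    by (intro Hausdorff_space_subtopology Hausdorff_quotient_by_constants)
  have space: "?G homeomorphic_space ?H"
    using hom by (rule homeomorphic_map_imp_homeomorphic_space)
  have range: "gromov_to_horo ` range Inl = range (horo_embedding :: 'a \<Rightarrow> _)"
    by (simp add: gromov_to_horo_comp_Inl[symmetric] image_comp)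
  have dH: "?H closure_of range horo_embedding = topspace ?H"
  proof -
    have "gromov_to_horo ` range Inl \<subseteq> gromov_to_horo ` topspace ?G"
      by (intro image_mono) (auto simp: topspace_gromov_compactification)
    then have "range horo_embedding \<subseteq> (horo_points :: ('a \<Rightarrow> real) set set)"
      unfolding range homeomorphic_imp_surjective_map[OF hom]
      by (simp add: horo_compactification_def)
    then have "?H closure_of range horo_embedding = horo_points"
      by (simp add: horo_compactification_def closure_of_subtopology Int_absorb1
          flip: horo_points_def)
    then show ?thesis
      using horo_points_subset[where 'a = 'a] by (simp add: horo_compactification_def Int_absorb1)
  qed
  have dG: "?G closure_of range Inl = topspace ?G"
  proof -
    have sub: "range Inl \<subseteq> topspace ?G" by (auto simp: topspace_gromov_compactification)
    have "gromov_to_horo ` (?G closure_of range Inl) = gromov_to_horo ` topspace ?G"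
      using homeomorphic_map_closure_of[OF hom sub] dH homeomorphic_imp_surjective_map[OF hom]
      by (simp add: range)
    then show ?thesis
      using inj_on_image_eq_iff[OF homeomorphic_imp_injective_map[OF hom]
          closure_of_subset_topspace subset_refl] by simp
  qed
  have "embedding_map ?G ?H gromov_to_horo"
    using hom by (simp add: embedding_map_def homeomorphic_imp_surjective_map[OF hom])
  with embedding_map_Inl_gromov have eH: "embedding_map euclidean ?H horo_embedding"
    unfolding gromov_to_horo_comp_Inl[symmetric] by (rule embedding_map_compose)
  have "compactification Inl ?G"
    using homeomorphic_compact_space[OF space] homeomorphic_Hausdorff_space[OF space] cH hH dG
      embedding_map_Inl_gromov by (simp add: compactification_def)
  moreover have "compactification horo_embedding ?H"
    using cH hH eH dH by (simp add: compactification_def)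
  ultimately show ?thesis
    unfolding topologically_equivalent_def
    using hom gromov_to_horo_comp_Inl by (intro conjI exI[of _ gromov_to_horo])
qed

end

theorem theorem1p1:
  fixes p :: "'a::metric_space"
  assumes "proper_space TYPE('a)"
    and "geodesic_space TYPE('a)"
    and "gromov_hyperbolic TYPE('a)"
    and "approaching_geodesics TYPE('a)"
  shows
    "(\<forall>\<gamma>\<in>geodesic_rays. \<forall>y::'a. busemann_class \<gamma> y \<in> horo_boundary) \<and>
     (\<forall>\<gamma>\<in>geodesic_rays. \<forall>\<sigma>\<in>geodesic_rays. \<forall>y y'::'a.
        asymptotic \<gamma> \<sigma> \<longrightarrow> busemann_class \<gamma> y = busemann_class \<sigma> y') \<and>
     (\<forall>\<xi>\<in>gromov_boundary. \<forall>\<gamma>\<in>\<xi>. \<forall>y::'a. gromov_to_horo (Inr \<xi>) = busemann_class \<gamma> y) \<and>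
     (\<forall>x::'a. gromov_to_horo (Inl x) = horo_embedding x) \<and>
     homeomorphic_map (gromov_compactification p) horo_compactification gromov_to_horo \<and>
     topologically_equivalent Inl (gromov_compactification p)
       horo_embedding (horo_compactification :: ('a \<Rightarrow> real) set topology)"
proof -
  obtain \<delta> where "0 \<le> \<delta>" and slim: "\<forall>x y z::'a. \<forall>A\<in>geodesic_sides x y.
     \<forall>B\<in>geodesic_sides y z. \<forall>C\<in>geodesic_sides z x. \<forall>a\<in>A. \<exists>b\<in>B \<union> C. dist a b \<le> \<delta>"
    using assms(3) unfolding gromov_hyperbolic_def by blast
  interpret approaching_geodesics_space \<delta> p
    using assms \<open>0 \<le> \<delta>\<close> slim[rule_format] by unfold_locales
  show ?thesis
    by (intro conjI ballI allI impI busemann_class_in_boundary busemann_class_asymptotic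
        gromov_to_horo_Inr homeomorphic_map_gromov_to_horo topologically_equivalent_gromov_horo)
      (simp_all add: gromov_to_horo_def)
qed

end
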